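(* Let $K,N,M_a\ge 1$ be integers, let $W,\sigma^2,\eta>0$ and $P_{\rm c}:=M_aP_{\rm dyn}+P_{\rm sta}>0$, and let $\mathbf H_1,\dots,\mathbf H_K\in\mathbb C^{N\times M_a}$. Fix $i\in\{1,\dots,K\}$ and Hermitian positive semidefinite transmit covariances $\mathbf Q_j$, $j\ne i$. Set $$a_i=\frac1\eta\sum_{j\ne i}\mathrm{Tr}(\mathbf Q_j)+P_{\rm c},\qquad b_i=W\log_2\Big|\mathbf I+\frac1{\sigma^2}\sum_{j\neq i}\mathbf H_j^H\mathbf Q_j\mathbf H_j\Big|,\qquad \mathbf G_i=\mathbf H_i\Big(\sigma^2\mathbf I+\sum_{j\ne i}\mathbf H_j^H\mathbf Q_j\mathbf H_j\Big)^{-1/2},$$ and let $\mathbf G_i^H\mathbf G_i=\mathbf U\mathbf D_i\mathbf U^H$ be an eigenvalue decomposition with $\mathbf U\in\mathbb C^{M_a\times M_a}$ unitary and $\mathbf D_i=\mathrm{diag}(d_1,\dots,d_{M_a})$, where $d_1,\dots,d_L>0$ and $d_{L+1}=\dots=d_{M_a}=0$ ($1\le L\le M_a$). For $\lambda>0$ let $$\mathbf S_i^{\lambda}=\mathrm{diag}(s_1^\lambda,\dots,s_{M_a}^\lambda),\qquad s_k^\lambda=\left[\frac{\eta}{\lambda\ln 2}-\frac1{d_k}\right]^+\ (1\le k\le L),\qquad s_k^\lambda=0\ (k>L).$$ Then for given $\lambda$ the optimal solution of $$\max_{\mathbf Q_i\succeq 0}\ b_i+W\log_2\left|\mathbf I+\mathbf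 G_i^H\mathbf Q_i\mathbf G_i\right|-\lambda\left(\frac{\mathrm{Tr}(\mathbf Q_i)}{\eta}+a_i\right)$$ is $\mathbf Q_i^\lambda=\mathbf U\mathbf S_i^\lambda\mathbf U^H$. Moreover the equation $$b_i+\sum_{k=1}^L\log_2\!\left(1+\left[\frac{\eta}{\lambda^*\ln 2}-\frac1{d_k}\right]^+d_k\right)-\lambda^*\left(\frac1\eta\sum_{k=1}^L\left[\frac{\eta}{\lambda^*\ln 2}-\frac1{d_k}\right]^++a_i\right)=0$$ has a unique solution $\lambda^*$, and the problem $$\max_{\mathbf Q_i\succeq0}\ \frac{W\log_2\left|\mathbf I+\frac1{\sigma^2}\sum_{j=1}^K\mathbf H_j^H\mathbf Q_j\mathbf H_j\right|}{\frac1\eta\sum_{j=1}^K\mathrm{Tr}(\mathbf Q_j)+P_{\rm c}}=\max_{\mathbf Q_i\succeq0}\ \frac{b_i+W\log_2\left|\mathbf I+\mathbf G_i^H\mathbf Q_i\mathbf G_i\right|}{\frac{\mathrm{Tr}(\mathbf Q_i)}{\eta}+a_i}$$ (maximization over $\mathbf Q_i$ only, the other $\mathbf Q_j$ being fixed) has the unique, globally optimal solution $$\mathbf Q_i^*=\mathbf U\,\mathbf S_i^{\lambda^*}\,\mathbf U^H .$$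
   Context: $|\cdot|$ denotes the determinant, $^H$ the conjugate transpose, $\mathbf Q\succeq 0$ means Hermitian positive semidefinite, and $[x]^+=\max(x,0)$. The objective is the energy efficiency (sum-rate over total power) of a MIMO multiple-access channel with $K$ users having $N$ antennas each and a base station with $M_a$ active antennas; $\mathbf H_j$ is the channel matrix and $\mathbf Q_j$ (the covariance of an $N$-dimensional transmit signal) the transmit covariance of user $j$; $W$ is the bandwidth, $\sigma^2$ the noise power, $\eta$ the power amplifier efficiency and $M_aP_{\rm dyn}+P_{\rm sta}$ the transmit-independent power.
   Formalization: The decomposition is taken of G_i G_i^H (U, D_i, S_i of size N×N, L ≤ N) instead of G_i^H G_i, and the factor W is inserted: the water level is Wη/(λ ln 2), and the sum of log_2 terms in the equation for λ* is multiplied by W. *)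

theory Defs
  imports "Jordan_Normal_Form.Schur_Decomposition"
begin

text \<open>Matrix entries are indexed from 0, as in \<^theory>\<open>Jordan_Normal_Form.Matrix\<close>;
  users are numbered from 1.\<close>

text \<open>For a Hermitian matrix the quadratic form is real, so taking the real part only
  changes the type.\<close>

definition psd_mat :: "nat \<Rightarrow> complex mat \<Rightarrow> bool" where
  "psd_mat n A \<longleftrightarrow> A \<in> carrier_mat n n \<and> mat_adjoint A = A \<and>
     (\<forall>v \<in> carrier_vec n. 0 \<le> Re ((A *\<^sub>v v) \<bullet>c v))"

definition unitary_mat :: "nat \<Rightarrow> complex mat \<Rightarrow> bool" where
  "unitary_mat n U \<longleftrightarrow> U \<in> carrier_mat n n \<and>
     mat_adjoint U * U = 1\<^sub>m n \<and> U * mat_adjoint U = 1\<^sub>m n"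

text \<open>The positive semidefinite square root of the inverse; meaningful for Hermitian
  positive definite arguments only.\<close>

definition inv_sqrt_mat :: "complex mat \<Rightarrow> complex mat" where
  "inv_sqrt_mat A = (THE B. psd_mat (dim_row A) B \<and> inverts_mat A (B * B))"

text \<open>The following two are used for Hermitian matrices only, whose determinant and trace
  are real.\<close>

definition real_det :: "complex mat \<Rightarrow> real" where
  "real_det A = Re (det A)"

definition real_trace :: "complex mat \<Rightarrow> real" where
  "real_trace A = Re (\<Sum>k<dim_row A. A $$ (k, k))"

definition real_diag :: "nat \<Rightarrow> (nat \<Rightarrow> real) \<Rightarrow> complex mat" where
  "real_diag n f = mat_diag n (\<lambda>k. complex_of_real (f k))"

text \<open>The sum of \<open>H\<^sub>j\<^sup>H Q\<^sub>j H\<^sub>j\<close> over the users \<open>j \<in> J\<close>, written entrywise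
  so that the empty sum is the zero matrix of dimension \<open>M\<close>.\<close>

definition rx_cov ::
  "nat \<Rightarrow> (nat \<Rightarrow> complex mat) \<Rightarrow> (nat \<Rightarrow> complex mat) \<Rightarrow> nat set \<Rightarrow> complex mat" where
  "rx_cov M H Q J =
     mat M M (\<lambda>(r, c). \<Sum>j\<in>J. (mat_adjoint (H j) * Q j * H j) $$ (r, c))"

definition sum_rate ::
  "real \<Rightarrow> real \<Rightarrow> nat \<Rightarrow> (nat \<Rightarrow> complex mat) \<Rightarrow> (nat \<Rightarrow> complex mat) \<Rightarrow> nat set \<Rightarrow> real"
  where
  "sum_rate W noise M H Q J =
     W * log 2 (real_det (1\<^sub>m M + complex_of_real (1 / noise) \<cdot>\<^sub>m rx_cov M H Q J))"

definition total_power ::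
  "real \<Rightarrow> real \<Rightarrow> (nat \<Rightarrow> complex mat) \<Rightarrow> nat set \<Rightarrow> real" where
  "total_power \<eta> Pc Q J = 1 / \<eta> * (\<Sum>j\<in>J. real_trace (Q j)) + Pc"

end

theory Submission
  imports Defs "Jordan_Normal_Form.Spectral_Radius"
begin

text \<open>Whitening and \<open>det (I + A B) = det (I + B A)\<close> turn the rate into
  \<open>b + W log\<^sub>2 det (I + Y D)\<close> with \<open>Y = U\<^sup>H X U\<close> and \<open>tr Y = tr X\<close>. The tangent of the
  log-determinant at a diagonal matrix bounds it by a function of the diagonal entries of \<open>Y\<close>
  alone, and at the water level every slope \<open>W d\<^sub>k / (ln 2 (1 + d\<^sub>k s\<^sub>k)) - l / \<eta>\<close> either
  vanishes or is negative at \<open>s\<^sub>k = 0\<close>; the equality case of the tangent bound gives uniqueness.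
  Hence \<open>\<Phi> l\<close> is the maximum of rate minus \<open>l\<close> times power. It is continuous and strictly
  decreasing with a sign change, and at its zero \<open>l\<close> (Dinkelbach) rate \<open>\<le>\<close> \<open>l\<close> times power,
  with equality exactly at the water-filling solution.\<close>

subsection \<open>Adjoints, positive semidefinite and diagonal matrices\<close>

lemma dim_mat_adjoint [simp]:
  "dim_row (mat_adjoint A) = dim_col A" "dim_col (mat_adjoint A) = dim_row A"
  by (auto simp: mat_adjoint_def)

lemma mat_adjoint_carrier [simp, intro]:
  "A \<in> carrier_mat n m \<Longrightarrow> mat_adjoint A \<in> carrier_mat m n"
  by (rule carrier_matI) auto

lemma index_mat_adjoint [simp]:
  fixes A :: "complex mat"
  shows "i < dim_col A \<Longrightarrow> j < dim_row A \<Longrightarrow> mat_adjoint A $$ (i, j) = cnj (A $$ (j, i))"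
  unfolding mat_adjoint_def by (subst mat_of_rows_index) auto

lemma mat_adjoint_adjoint [simp]:
  fixes A :: "complex mat"
  shows "mat_adjoint (mat_adjoint A) = A"
  by (rule eq_matI) auto

lemma mat_adjoint_mult:
  fixes A B :: "complex mat"
  assumes "A \<in> carrier_mat n m" "B \<in> carrier_mat m p"
  shows "mat_adjoint (A * B) = mat_adjoint B * mat_adjoint A"
  using assms by (intro eq_matI) (auto simp: scalar_prod_def mult.commute)

lemma mat_adjoint_add:
  fixes A B :: "complex mat"
  assumes "A \<in> carrier_mat n m" "B \<in> carrier_mat n m"
  shows "mat_adjoint (A + B) = mat_adjoint A + mat_adjoint B"
  using assms by (intro eq_matI) auto

lemma mat_adjoint_smult:
  fixes A :: "complex mat"
  shows "mat_adjoint (c \<cdot>\<^sub>m A) = cnj c \<cdot>\<^sub>m mat_adjoint A"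
  by (intro eq_matI) auto

lemma mat_adjoint_one [simp]: "mat_adjoint (1\<^sub>m n :: complex mat) = 1\<^sub>m n"
  by (intro eq_matI) auto

lemma mat_adjoint_congruence:
  fixes A C :: "complex mat"
  assumes "A \<in> carrier_mat n n" "mat_adjoint A = A" "C \<in> carrier_mat m n"
  shows "mat_adjoint (C * A * mat_adjoint C) = C * A * mat_adjoint C"
proof -
  have "mat_adjoint (C * A * mat_adjoint C) = C * mat_adjoint (C * A)"
    using assms by (subst mat_adjoint_mult[of _ m n _ m]) auto
  also have "mat_adjoint (C * A) = A * mat_adjoint C"
    using assms by (subst mat_adjoint_mult[of _ m n _ n]) auto
  finally show ?thesis using assms by (simp add: assoc_mult_mat[of C m n A n _ m])
qed

lemma cscalar_prod_mult_vec:
  fixes A :: "complex mat"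
  assumes "A \<in> carrier_mat n m" "v \<in> carrier_vec m" "w \<in> carrier_vec n"
  shows "(A *\<^sub>v v) \<bullet>c w = v \<bullet>c (mat_adjoint A *\<^sub>v w)"
proof -
  have "(A *\<^sub>v v) \<bullet>c w = (\<Sum>i<n. \<Sum>j<m. A $$ (i, j) * v $ j * cnj (w $ i))"
    using assms by (auto simp: scalar_prod_def sum_distrib_right lessThan_atLeast0 intro!: sum.cong)
  also have "\<dots> = (\<Sum>j<m. \<Sum>i<n. A $$ (i, j) * v $ j * cnj (w $ i))"
    by (rule sum.swap)
  also have "\<dots> = v \<bullet>c (mat_adjoint A *\<^sub>v w)"
    using assms by (auto simp: scalar_prod_def sum_distrib_left lessThan_atLeast0 mult_ac intro!: sum.cong)
  finally show ?thesis .
qed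

text \<open>With \<open>w = mat_adjoint C *\<^sub>v v\<close>, the quadratic form of
  \<open>C * A * mat_adjoint C\<close> at \<open>v\<close> is that of \<open>A\<close> at
  \<open>w\<close>. \<open>C\<close> may be rectangular, as the channel matrices are.\<close>

lemma psd_mat_congruence:
  assumes "psd_mat n A" "C \<in> carrier_mat m n"
  shows "psd_mat m (C * A * mat_adjoint C)"
  unfolding psd_mat_def
proof (intro conjI ballI)
  have A: "A \<in> carrier_mat n n" "mat_adjoint A = A" using assms by (auto simp: psd_mat_def)
  show "C * A * mat_adjoint C \<in> carrier_mat m m" using A assms by auto
  show "mat_adjoint (C * A * mat_adjoint C) = C * A * mat_adjoint C"
    using mat_adjoint_congruence A assms by blast
  fix v :: "complex vec" assume v: "v \<in> carrier_vec m"
  have w: "mat_adjoint C *\<^sub>v v \<in> carrier_vec n" (is "?w \<in> _") using assms v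
    by (metis mat_adjoint_carrier mult_mat_vec_carrier)
  have "C * A * mat_adjoint C *\<^sub>v v = C *\<^sub>v (A *\<^sub>v ?w)"
    using A assms v w by (simp add: assoc_mult_mat_vec[of _ m n _ m] assoc_mult_mat_vec[of _ m n _ n])
  moreover have "A *\<^sub>v ?w \<in> carrier_vec n" using A w by auto
  ultimately have "(C * A * mat_adjoint C *\<^sub>v v) \<bullet>c v = (A *\<^sub>v ?w) \<bullet>c ?w"
    using cscalar_prod_mult_vec[OF assms(2) _ v] by auto
  thus "0 \<le> Re ((C * A * mat_adjoint C *\<^sub>v v) \<bullet>c v)"
    using assms w by (simp add: psd_mat_def)
qed

lemma psd_mat_congruence':
  assumes "psd_mat n A" "C \<in> carrier_mat n m"
  shows "psd_mat m (mat_adjoint C * A * C)"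
  using psd_mat_congruence[OF assms(1) mat_adjoint_carrier[OF assms(2)]] by simp

lemma psd_mat_add:
  assumes "psd_mat n A" "psd_mat n B"
  shows "psd_mat n (A + B)"
proof -
  have AB: "A \<in> carrier_mat n n" "B \<in> carrier_mat n n" using assms by (auto simp: psd_mat_def)
  have "((A + B) *\<^sub>v v) \<bullet>c v = (A *\<^sub>v v) \<bullet>c v + (B *\<^sub>v v) \<bullet>c v" if "v \<in> carrier_vec n" for v
    using AB that by (simp add: add_mult_distrib_mat_vec[of _ n n] add_scalar_prod_distrib[of _ n])
  thus ?thesis using assms AB by (auto simp: psd_mat_def mat_adjoint_add[of _ n n])
qed

lemma psd_mat_smult:
  assumes "psd_mat n A" "c \<ge> 0"
  shows "psd_mat n (complex_of_real c \<cdot>\<^sub>m A)"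
proof -
  have A: "A \<in> carrier_mat n n" using assms by (auto simp: psd_mat_def)
  have "((complex_of_real c \<cdot>\<^sub>m A) *\<^sub>v v) \<bullet>c v = complex_of_real c * ((A *\<^sub>v v) \<bullet>c v)" if "v \<in> carrier_vec n" for v
    using A that by (simp add: scalar_prod_def sum_distrib_left mult_ac)
  thus ?thesis using assms A by (auto simp: psd_mat_def mat_adjoint_smult)
qed

lemma psd_mat_diag_entry:
  assumes "psd_mat n A" "k < n"
  shows "0 \<le> Re (A $$ (k, k))"
proof -
  have A: "A \<in> carrier_mat n n" using assms by (auto simp: psd_mat_def)
  have "A *\<^sub>v unit_vec n k = col A k" using A assms by (intro eq_vecI) auto
  moreover have "conjugate (unit_vec n k) = (unit_vec n k :: complex vec)"
    by (rule eq_vecI) (auto simp: unit_vec_def)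
  ultimately have "(A *\<^sub>v unit_vec n k) \<bullet>c unit_vec n k = A $$ (k, k)"
    using A assms by auto
  thus ?thesis using assms by (auto simp: psd_mat_def dest!: bspec[of _ _ "unit_vec n k"])
qed

lemma hermitian_diag_real:
  fixes A :: "complex mat"
  assumes "mat_adjoint A = A" "A \<in> carrier_mat n n" "k < n"
  shows "A $$ (k, k) = complex_of_real (Re (A $$ (k, k)))"
proof -
  have "cnj (A $$ (k, k)) = A $$ (k, k)" using index_mat_adjoint[of k A k] assms by auto
  thus ?thesis by (metis Reals_cnj_iff of_real_Re)
qed

section \<open>Real diagonal matrices\<close>

lemma psd_mat_real_diag:
  assumes "\<And>k. k < n \<Longrightarrow> f k \<ge> 0"
  shows "psd_mat n (real_diag n f)"
  unfolding psd_mat_def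
proof (intro conjI ballI)
  show "real_diag n f \<in> carrier_mat n n" by (simp add: real_diag_def)
  show "mat_adjoint (real_diag n f) = real_diag n f"
    by (rule eq_matI) (auto simp: real_diag_def mat_diag_def)
  fix v :: "complex vec" assume v: "v \<in> carrier_vec n"
  have "(real_diag n f *\<^sub>v v) \<bullet>c v = (\<Sum>k<n. complex_of_real (f k) * v $ k * cnj (v $ k))"
    using v by (auto simp: real_diag_def mat_diag_def scalar_prod_def lessThan_atLeast0 if_distrib[of "\<lambda>x. x * _"]
        intro!: sum.cong cong: if_cong)
  also have "Re \<dots> = (\<Sum>k<n. f k * (cmod (v $ k))\<^sup>2)"
    by (simp add: mult.assoc complex_mult_cnj cmod_power2)
  also have "\<dots> \<ge> 0" using assms by (intro sum_nonneg mult_nonneg_nonneg) auto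
  finally show "0 \<le> Re ((real_diag n f *\<^sub>v v) \<bullet>c v)" .
qed

lemma real_diag_carrier [simp, intro]: "real_diag n f \<in> carrier_mat n n"
  by (simp add: real_diag_def)

lemma dim_real_diag [simp]: "dim_row (real_diag n f) = n" "dim_col (real_diag n f) = n"
  by (simp_all add: real_diag_def mat_diag_def)

lemma index_real_diag [simp]:
  "i < n \<Longrightarrow> j < n \<Longrightarrow> real_diag n f $$ (i, j) = (if i = j then complex_of_real (f i) else 0)"
  by (simp add: real_diag_def mat_diag_def)

lemma mat_adjoint_real_diag [simp]: "mat_adjoint (real_diag n f) = real_diag n f"
  by (rule eq_matI) auto

lemma real_diag_mult [simp]: "real_diag n f * real_diag n g = real_diag n (\<lambda>k. f k * g k)"
  by (simp add: real_diag_def)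

lemma real_diag_add: "real_diag n f + real_diag n g = real_diag n (\<lambda>k. f k + g k)"
  by (rule eq_matI) auto

lemma real_diag_one: "1\<^sub>m n = real_diag n (\<lambda>k. 1)"
  by (rule eq_matI) auto

lemma smult_real_diag: "complex_of_real c \<cdot>\<^sub>m real_diag n f = real_diag n (\<lambda>k. c * f k)"
  by (rule eq_matI) auto

lemma real_diag_cong: "(\<And>k. k < n \<Longrightarrow> f k = g k) \<Longrightarrow> real_diag n f = real_diag n g"
  by (rule eq_matI) auto

lemma index_real_diag_mult_left:
  assumes "A \<in> carrier_mat n m" "i < n" "j < m"
  shows "(real_diag n f * A) $$ (i, j) = complex_of_real (f i) * A $$ (i, j)"
  using assms by (simp add: real_diag_def mat_diag_mult_left[of _ _ m])

lemma index_real_diag_mult_right: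
  assumes "A \<in> carrier_mat m n" "i < m" "j < n"
  shows "(A * real_diag n f) $$ (i, j) = A $$ (i, j) * complex_of_real (f j)"
  using assms by (simp add: real_diag_def mat_diag_mult_right[of _ m])

lemma det_real_diag: "det (real_diag n f) = complex_of_real (\<Prod>k<n. f k)"
proof -
  have "upper_triangular (real_diag n f)" by (auto simp: upper_triangular_def)
  hence "det (real_diag n f) = prod_list (diag_mat (real_diag n f))"
    by (rule det_upper_triangular) auto
  also have "diag_mat (real_diag n f) = map (\<lambda>k. complex_of_real (f k)) [0..<n]"
    by (auto simp: diag_mat_def)
  also have "prod_list \<dots> = complex_of_real (\<Prod>k<n. f k)"
    by (simp add: prod.list_conv_set_nth lessThan_atLeast0)
  finally show ?thesis .
qed

section \<open>Traces, and exchanging factors under the determinant\<close>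

lemma real_trace_real_diag: "real_trace (real_diag n f) = (\<Sum>k<n. f k)"
  by (simp add: real_trace_def)

lemma real_trace_nonneg: "psd_mat n A \<Longrightarrow> real_trace A \<ge> 0"
  using psd_mat_diag_entry[of n A] by (auto simp: real_trace_def psd_mat_def intro!: sum_nonneg)

lemma real_trace_mult_commute:
  assumes "A \<in> carrier_mat n m" "B \<in> carrier_mat m n"
  shows "real_trace (A * B) = real_trace (B * A)"
proof -
  have "(\<Sum>k<n. (A * B) $$ (k, k)) = (\<Sum>k<n. \<Sum>j<m. A $$ (k, j) * B $$ (j, k))"
    using assms by (auto simp: scalar_prod_def lessThan_atLeast0)
  also have "\<dots> = (\<Sum>j<m. \<Sum>k<n. B $$ (j, k) * A $$ (k, j))"
    by (subst sum.swap) (simp add: mult.commute)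
  also have "\<dots> = (\<Sum>j<m. (B * A) $$ (j, j))"
    using assms by (auto simp: scalar_prod_def lessThan_atLeast0)
  finally show ?thesis using assms by (simp add: real_trace_def)
qed

text \<open>Multiplying \<open>?M\<close> and \<open>?T\<close> in the two orders gives block
  triangular matrices with equal determinants; the diagonal blocks are an identity and one of the
  two matrices compared. No inverse is involved, and the factors may be rectangular.\<close>

lemma det_one_plus_mult_commute:
  fixes A B :: "'a :: idom mat"
  assumes A: "A \<in> carrier_mat n m" and B: "B \<in> carrier_mat m n"
  shows "det (1\<^sub>m n + A * B) = det (1\<^sub>m m + B * A)"
proof -
  let ?M = "four_block_mat (1\<^sub>m n) (- A) B (1\<^sub>m m)"
  let ?T = "four_block_mat (1\<^sub>m n) A (0\<^sub>m m n) (1\<^sub>m m)"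
  have M: "?M \<in> carrier_mat (n + m) (n + m)" and T: "?T \<in> carrier_mat (n + m) (n + m)"
    using A B by auto
  have AA: "A + - A = 0\<^sub>m n m" "- A + A = 0\<^sub>m n m" using A by auto
  have l: "?M * ?T = four_block_mat (1\<^sub>m n) (0\<^sub>m n m) B (B * A + 1\<^sub>m m)"
    using A B AA by (subst mult_four_block_mat[of _ n n _ m _ m]) auto
  have r: "?T * ?M = four_block_mat (1\<^sub>m n + A * B) (0\<^sub>m n m) B (1\<^sub>m m)"
    using A B AA by (subst mult_four_block_mat[of _ n n _ m _ m]) auto
  have "det ?M * det ?T = det (?M * ?T)" using det_mult[OF M T] by simp
  also have "\<dots> = det (B * A + 1\<^sub>m m)" unfolding l
    by (subst det_four_block_mat_upper_right_zero[of _ n _ m]) (use A B in auto)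
  also have "\<dots> = det (1\<^sub>m m + B * A)" using A B by (simp add: comm_add_mat[of _ m m])
  finally have 1: "det ?M * det ?T = det (1\<^sub>m m + B * A)" .
  have "det ?T * det ?M = det (?T * ?M)" using det_mult[OF T M] by simp
  also have "\<dots> = det (1\<^sub>m n + A * B)" unfolding r
    by (subst det_four_block_mat_upper_right_zero[of _ n _ m]) (use A B in auto)
  finally show ?thesis using 1 by (simp add: mult.commute)
qed

subsection \<open>The spectral theorem and its consequences\<close>

lemma mult_square_carrier [simp]:
  fixes A B :: "complex mat"
  shows "A \<in> carrier_mat n n \<Longrightarrow> B \<in> carrier_mat n n \<Longrightarrow> A * B \<in> carrier_mat n n"
  by (rule mult_carrier_mat)

lemma unitary_matD:
  assumes "unitary_mat n U"
  shows "U \<in> carrier_mat n n" "mat_adjoint U \<in> carrier_mat n n"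
    "mat_adjoint U * U = 1\<^sub>m n" "U * mat_adjoint U = 1\<^sub>m n"
  using assms by (auto simp: unitary_mat_def)

lemma unitary_matI:
  assumes "U \<in> carrier_mat n n" "mat_adjoint U * U = 1\<^sub>m n"
  shows "unitary_mat n U"
  using assms mat_mult_left_right_inverse[of "mat_adjoint U" n U] by (auto simp: unitary_mat_def)

lemma unitary_mat_adjoint: "unitary_mat n U \<Longrightarrow> unitary_mat n (mat_adjoint U)"
  by (auto simp: unitary_mat_def)

lemma unitary_mat_mult:
  assumes "unitary_mat n U" "unitary_mat n V"
  shows "unitary_mat n (U * V)"
proof (rule unitary_matI)
  note U = unitary_matD[OF assms(1)] and V = unitary_matD[OF assms(2)]
  show "U * V \<in> carrier_mat n n" using U V by auto
  have "mat_adjoint (U * V) * (U * V) = mat_adjoint V * ((mat_adjoint U * U) * V)"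
    using U(1,2) V(1,2) by (simp add: mat_adjoint_mult[of _ n n _ n] assoc_mult_mat[of _ n n _ n _ n])
  thus "mat_adjoint (U * V) * (U * V) = 1\<^sub>m n" using U V by simp
qed

lemma unitary_conj_cancel:
  assumes "unitary_mat n U" "A \<in> carrier_mat n n"
  shows "U * (mat_adjoint U * A * U) * mat_adjoint U = A"
proof -
  note U = unitary_matD[OF assms(1)]
  have "U * (mat_adjoint U * A * U) * mat_adjoint U = (U * mat_adjoint U) * A * (U * mat_adjoint U)"
    using U(1,2) assms(2) by (simp add: assoc_mult_mat[of _ n n _ n _ n])
  thus ?thesis unfolding U(4) using assms(2) by simp
qed

lemma unitary_conj_cancel':
  assumes "unitary_mat n U" "A \<in> carrier_mat n n"
  shows "mat_adjoint U * (U * A * mat_adjoint U) * U = A"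
  using unitary_conj_cancel[OF unitary_mat_adjoint[OF assms(1)] assms(2)] by simp

text \<open>Completing \<open>v\<close> to a basis and applying Gram-Schmidt gives orthogonal
  columns starting with \<open>v\<close>; normalising them makes the matrix unitary and only
  rescales \<open>v\<close>.\<close>

lemma exists_unitary_first_col:
  fixes v :: "complex vec"
  assumes v: "v \<in> carrier_vec n" and v0: "v \<noteq> 0\<^sub>v n"
  shows "\<exists>W c. unitary_mat n W \<and> col W 0 = c \<cdot>\<^sub>v v"
proof -
  interpret cof_vec_space n "TYPE(complex)" .
  have n: "n > 0" using v v0 by (cases n) auto
  define ws where "ws = gram_schmidt n (basis_completion v)"
  \<comment> \<open>The reciprocal norm of column \<open>j\<close>. It is real, so conjugation
    leaves it unchanged.\<close>
  define r where "r j = complex_of_real (1 / sqrt (Re (ws ! j \<bullet>c ws ! j)))" for j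
  have cr: "cnj (r j) = r j" for j by (simp add: r_def)
  define W where "W = mat n n (\<lambda>(i, j). r j * ws ! j $ i)"
  note bc = basis_completion[OF v v0]
  from gram_schmidt_result[OF bc(2,4,5) refl, folded ws_def] bc(6)
  have ws: "set ws \<subseteq> carrier_vec n" "corthogonal ws" "length ws = n" by auto
  have "ws ! 0 = hd ws" using ws n by (cases ws) auto
  also have "\<dots> = v"
    unfolding ws_def using bc(6,7) n gram_schmidt_hd[OF v, of "tl (basis_completion v)"]
    by (cases "basis_completion v") auto
  finally have ws0: "ws ! 0 = v" .
  have wsc: "ws ! j \<in> carrier_vec n" if "j < n" for j using ws that by auto
  have W: "W \<in> carrier_mat n n" by (simp add: W_def)
  have "mat_adjoint W * W = 1\<^sub>m n"
  proof (rule eq_matI)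
    fix i j assume "i < dim_row (1\<^sub>m n :: complex mat)" "j < dim_col (1\<^sub>m n :: complex mat)"
    hence ij: "i < n" "j < n" by auto
    have "(mat_adjoint W * W) $$ (i, j) = (\<Sum>k = 0..<n. cnj (r i * ws ! i $ k) * (r j * ws ! j $ k))"
      using ij W by (simp add: scalar_prod_def W_def)
    also have "\<dots> = r i * r j * (\<Sum>k = 0..<n. ws ! j $ k * cnj (ws ! i $ k))"
      by (simp add: cr sum_distrib_left mult_ac)
    also have "\<dots> = r i * r j * (ws ! j \<bullet>c ws ! i)"
      using ij wsc[of i] wsc[of j] by (simp add: scalar_prod_def)
    also have "\<dots> = 1\<^sub>m n $$ (i, j)"
    proof (cases "i = j")
      case True
      let ?w = "ws ! i \<bullet>c ws ! i"
      have "?w \<noteq> 0" using corthogonalD[OF ws(2), of i i] ij ws by auto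
      \<comment> \<open>Nonnegativity in the order on complex numbers includes a zero imaginary
        part, so \<open>?w\<close> is a positive real.\<close>
      moreover have "?w \<ge> 0" by (rule conjugate_square_ge_0_vec)
      ultimately have "Re ?w > 0" "?w = complex_of_real (Re ?w)"
        by (auto simp: less_eq_complex_def complex_eq_iff less_le)
      moreover from this have "r i * r i = complex_of_real (1 / Re ?w)"
        by (simp add: r_def flip: of_real_mult)
      ultimately have "r i * r i * ?w = 1" 
        by (metis nonzero_divide_eq_eq of_real_1 of_real_mult less_irrefl)
      thus ?thesis using True ij by simp
    next
      case False
      thus ?thesis using corthogonalD[OF ws(2), of j i] ij ws by auto
    qed
    finally show "(mat_adjoint W * W) $$ (i, j) = 1\<^sub>m n $$ (i, j)" .
  qed (use W in auto)
  hence "unitary_mat n W" using W by (rule unitary_matI[rotated])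
  moreover have "col W 0 = r 0 \<cdot>\<^sub>v v"
    using n v ws0 by (intro eq_vecI) (auto simp: W_def)
  ultimately show ?thesis by blast
qed

text \<open>Deflation: a unitary matrix whose first column is an eigenvector turns \<open>A\<close>
  into a Hermitian matrix that splits into a 1 x 1 block and a block of size \<open>n\<close>, to
  which the induction hypothesis applies.\<close>

lemma hermitian_spectral:
  fixes A :: "complex mat"
  assumes "A \<in> carrier_mat n n" "mat_adjoint A = A"
  shows "\<exists>V f. unitary_mat n V \<and> A = V * real_diag n f * mat_adjoint V"
  using assms
proof (induction n arbitrary: A)
  case 0
  have "unitary_mat 0 (1\<^sub>m 0)" by (rule unitary_matI) auto
  moreover have "A = 1\<^sub>m 0 * real_diag 0 (\<lambda>_. 0) * mat_adjoint (1\<^sub>m 0)"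
    using 0 by (intro eq_matI) auto
  ultimately show ?case by blast
next
  case (Suc n)
  obtain e where "e \<in> spectrum A" using spectrum_non_empty[OF Suc.prems(1)] by auto
  then obtain v where "eigenvector A v e" by (auto simp: spectrum_def eigenvalue_def)
  hence v: "v \<in> carrier_vec (Suc n)" "v \<noteq> 0\<^sub>v (Suc n)" "A *\<^sub>v v = e \<cdot>\<^sub>v v"
    using Suc.prems by (auto simp: eigenvector_def)
  obtain W c where W: "unitary_mat (Suc n) W" and c: "col W 0 = c \<cdot>\<^sub>v v"
    using exists_unitary_first_col[OF v(1,2)] by blast
  note W' = unitary_matD[OF W]
  define B where "B = mat_adjoint W * A * W"
  have B: "B \<in> carrier_mat (Suc n) (Suc n)" using W' Suc.prems by (auto simp: B_def)
  have adjB: "mat_adjoint B = B"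
    using mat_adjoint_congruence[OF Suc.prems W'(2)] by (simp add: B_def)
  have AB: "A = W * B * mat_adjoint W"
    unfolding B_def using unitary_conj_cancel[OF W Suc.prems(1)] by simp
  have Wc: "A *\<^sub>v col W 0 = e \<cdot>\<^sub>v col W 0"
    using v Suc.prems by (simp add: c mult_mat_vec smult_smult_assoc mult.commute)
  \<comment> \<open>Column 0 of \<open>mat_adjoint W * A * W\<close> is \<open>e\<close> times
    column 0 of \<open>mat_adjoint W * W\<close>, an identity matrix.\<close>
  have col0: "B $$ (i, 0) = (if i = 0 then e else 0)" if "i < Suc n" for i
  proof -
    have "B = mat_adjoint W * (A * W)"
      using W' Suc.prems by (simp add: B_def assoc_mult_mat[of _ "Suc n" "Suc n" _ "Suc n" _ "Suc n"])
    hence "B $$ (i, 0) = row (mat_adjoint W) i \<bullet> col (A * W) 0"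
      using W' Suc.prems that by simp
    also have "col (A * W) 0 = e \<cdot>\<^sub>v col W 0"
      using col_mult2[OF Suc.prems(1) W'(1)] Wc by simp
    also have "row (mat_adjoint W) i \<bullet> (e \<cdot>\<^sub>v col W 0) = e * (mat_adjoint W * W) $$ (i, 0)"
      using W'(1,2) that by simp
    finally show ?thesis using W' that by simp
  qed
  \<comment> \<open>Hermitian symmetry carries the zeros of column 0 over to row 0.\<close>
  have row0: "B $$ (0, i) = (if i = 0 then e else 0)" if "i < Suc n" for i
    using col0[OF that] index_mat_adjoint[of 0 B i] adjB B that by (cases "i = 0") auto
  define A3 where "A3 = mat n n (\<lambda>(i, j). B $$ (Suc i, Suc j))"
  have A3: "A3 \<in> carrier_mat n n" by (simp add: A3_def)
  have "mat_adjoint A3 = A3"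
  proof (rule eq_matI)
    fix i j assume "i < dim_row A3" "j < dim_col A3"
    hence "i < n" "j < n" by (auto simp: A3_def)
    thus "mat_adjoint A3 $$ (i, j) = A3 $$ (i, j)"
      using B adjB index_mat_adjoint[of "Suc i" B "Suc j"] by (simp add: A3_def)
  qed (auto simp: A3_def)
  then obtain V f where V: "unitary_mat n V" and A3V: "A3 = V * real_diag n f * mat_adjoint V"
    using Suc.IH[OF A3] by blast
  note V' = unitary_matD[OF V]
  let ?Z1 = "0\<^sub>m 1 n :: complex mat" and ?Z2 = "0\<^sub>m n 1 :: complex mat"
  \<comment> \<open>The eigenvalue is a diagonal entry of the Hermitian matrix \<open>B\<close>,
    hence real.\<close>
  have e: "e = complex_of_real (Re e)"
    using hermitian_diag_real[OF adjB B, of 0] col0[of 0] by simp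
  \<comment> \<open>Bordering \<open>V\<close> by a 1 leaves the split-off coordinate alone;
    \<open>f1\<close> puts its eigenvalue in front of \<open>f\<close>.\<close>
  define V1 where "V1 = four_block_mat (1\<^sub>m 1) ?Z1 ?Z2 V"
  define f1 where "f1 = case_nat (Re e) f"
  have V1: "V1 \<in> carrier_mat (Suc n) (Suc n)" using V' by (auto simp: V1_def)
  have adjV1: "mat_adjoint V1 = four_block_mat (1\<^sub>m 1) ?Z1 ?Z2 (mat_adjoint V)"
    using V' by (intro eq_matI) (auto simp: V1_def)
  have "mat_adjoint V1 * V1 = four_block_mat (1\<^sub>m 1) ?Z1 ?Z2 (mat_adjoint V * V)"
    unfolding adjV1 unfolding V1_def
    using V'(1,2) by (subst mult_four_block_mat[of _ 1 1 _ n _ n]) auto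
  also have "\<dots> = 1\<^sub>m (Suc n)" using V' by (simp add: four_block_one_mat)
  finally have uV1: "unitary_mat (Suc n) V1" by (rule unitary_matI[OF V1])
  have D1: "real_diag (Suc n) f1 = four_block_mat (mat 1 1 (\<lambda>_. e)) ?Z1 ?Z2 (real_diag n f)"
    using e by (intro eq_matI) (auto simp: f1_def split: nat.split)
  have "V1 * real_diag (Suc n) f1 * mat_adjoint V1
      = four_block_mat (mat 1 1 (\<lambda>_. e)) ?Z1 ?Z2 A3"
    unfolding D1 adjV1 A3V unfolding V1_def using V'(1,2)
    by (simp add: mult_four_block_mat[of _ 1 1 _ n _ n _ _ 1 _ n])
  also have "\<dots> = B"
    using B col0 row0 by (intro eq_matI) (auto simp: A3_def)
  finally have "B = V1 * real_diag (Suc n) f1 * mat_adjoint V1" by simp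
  hence "A = (W * V1) * real_diag (Suc n) f1 * mat_adjoint (W * V1)"
    unfolding AB using W'(1,2) V1
    by (simp add: mat_adjoint_mult[of _ "Suc n" "Suc n" _ "Suc n"]
        assoc_mult_mat[of _ "Suc n" "Suc n" _ "Suc n" _ "Suc n"])
  thus ?case using unitary_mat_mult[OF W uV1] by blast
qed

text \<open>The diagonal factor is congruent to \<open>A\<close>, hence itself positive
  semidefinite, and so its diagonal entries are nonnegative.\<close>

lemma psd_spectral:
  assumes "psd_mat n A"
  shows "\<exists>V f. unitary_mat n V \<and> (\<forall>k<n. f k \<ge> 0) \<and> A = V * real_diag n f * mat_adjoint V"
proof -
  obtain V f where V: "unitary_mat n V" and A: "A = V * real_diag n f * mat_adjoint V"
    using assms hermitian_spectral[of A n] by (auto simp: psd_mat_def)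
  have "psd_mat n (mat_adjoint V * A * V)"
    by (rule psd_mat_congruence'[OF assms unitary_matD(1)[OF V]])
  hence "psd_mat n (real_diag n f)"
    unfolding A by (simp add: unitary_conj_cancel'[OF V])
  hence "\<forall>k<n. f k \<ge> 0" using psd_mat_diag_entry by fastforce
  thus ?thesis using V A by blast
qed

text \<open>Since \<open>V * mat_adjoint V\<close> is the identity, adding a multiple of the
  identity shifts the eigenvalues and keeps the eigenbasis.\<close>

lemma unitary_conj_add_smult_one:
  assumes "unitary_mat n V"
  shows "complex_of_real c \<cdot>\<^sub>m 1\<^sub>m n + V * real_diag n f * mat_adjoint V
    = V * real_diag n (\<lambda>k. c + f k) * mat_adjoint V"
proof -
  note V = unitary_matD[OF assms]
  have "V * real_diag n (\<lambda>k. c + f k) * mat_adjoint V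
      = V * (complex_of_real c \<cdot>\<^sub>m 1\<^sub>m n + real_diag n f) * mat_adjoint V"
    by (simp add: real_diag_one smult_real_diag real_diag_add)
  also have "\<dots> = complex_of_real c \<cdot>\<^sub>m (V * mat_adjoint V) + V * real_diag n f * mat_adjoint V"
    using V(1,2) by (simp add: mult_add_distrib_mat[of _ n n _ n] add_mult_distrib_mat[of _ n n _ _ n]
       mult_smult_distrib[of _ n n _ n] mult_smult_assoc_mat[of _ n n _ n])
  finally show ?thesis using V by simp
qed

section \<open>Determinants, traces and square roots through the eigenvalues\<close>

lemma det_unitary_conj:
  assumes "unitary_mat n V" "A \<in> carrier_mat n n"
  shows "det (V * A * mat_adjoint V) = det A"
proof -
  note V = unitary_matD[OF assms(1)]
  have "det V * det (mat_adjoint V) = 1"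
    using V by (metis det_mult det_one)
  moreover have "det (V * A * mat_adjoint V) = det V * det A * det (mat_adjoint V)"
    using V(1,2) assms by (simp add: det_mult[of _ n])
  ultimately show ?thesis by (metis mult.assoc mult.commute mult_1)
qed

lemma real_trace_unitary_conj:
  assumes "unitary_mat n V" "A \<in> carrier_mat n n"
  shows "real_trace (V * A * mat_adjoint V) = real_trace A"
proof -
  note V = unitary_matD[OF assms(1)]
  have "real_trace (V * A * mat_adjoint V) = real_trace (mat_adjoint V * (V * A))"
    using V assms by (intro real_trace_mult_commute[of _ n n]) auto
  also have "mat_adjoint V * (V * A) = (mat_adjoint V * V) * A"
    using V(1,2) assms by (simp add: assoc_mult_mat[of _ n n _ n _ n])
  finally show ?thesis unfolding V(3) using assms by simp
qed

text \<open>The determinant is the product of the shifted eigenvalues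
  \<open>c + f k \<ge> c\<close>. The real witness \<open>r\<close> also records that
  \<open>real_det\<close> discards nothing by taking the real part.\<close>

lemma det_add_psd:
  assumes "psd_mat n P" "c > 0"
  shows "\<exists>r\<ge>c ^ n. det (complex_of_real c \<cdot>\<^sub>m 1\<^sub>m n + P) = complex_of_real r"
proof -
  obtain V f where V: "unitary_mat n V" and f: "\<forall>k<n. f k \<ge> 0"
    and P: "P = V * real_diag n f * mat_adjoint V"
    using psd_spectral[OF assms(1)] by blast
  have "det (complex_of_real c \<cdot>\<^sub>m 1\<^sub>m n + P) = complex_of_real (\<Prod>k<n. c + f k)"
    unfolding P unitary_conj_add_smult_one[OF V] by (simp add: det_unitary_conj[OF V] det_real_diag)
  moreover have "(\<Prod>k<n. c) \<le> (\<Prod>k<n. c + f k)"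
    using f assms by (intro prod_mono) auto
  ultimately show ?thesis by auto
qed

lemma det_one_add_psd:
  assumes "psd_mat n P"
  shows "\<exists>r\<ge>1. det (1\<^sub>m n + P) = complex_of_real r"
proof -
  have "complex_of_real 1 \<cdot>\<^sub>m 1\<^sub>m n = 1\<^sub>m n" by (intro eq_matI) auto
  thus ?thesis using det_add_psd[OF assms, of 1] by force
qed

text \<open>On the eigenvalues this is \<open>ln x \<le> x - 1\<close>.\<close>

lemma ln_det_le_trace:
  assumes "psd_mat n M" "real_det M > 0"
  shows "ln (real_det M) \<le> real_trace M - real n"
    and "ln (real_det M) = real_trace M - real n \<Longrightarrow> M = 1\<^sub>m n"
proof -
  obtain V f where V: "unitary_mat n V" and f: "\<forall>k<n. f k \<ge> 0"
    and M: "M = V * real_diag n f * mat_adjoint V"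
    using psd_spectral[OF assms(1)] by blast
  have det: "real_det M = (\<Prod>k<n. f k)"
    unfolding real_det_def M by (simp add: det_unitary_conj[OF V] det_real_diag flip: of_real_prod)
  have tr: "real_trace M = (\<Sum>k<n. f k)"
    unfolding M by (simp add: real_trace_unitary_conj[OF V] real_trace_real_diag)
  \<comment> \<open>A nonzero product has no zero factor; all eigenvalues are then positive and the
    logarithm splits.\<close>
  have "(\<Prod>k<n. f k) \<noteq> 0" using assms(2) unfolding det by linarith
  hence "f k \<noteq> 0" if "k < n" for k using that by auto
  hence f: "f k > 0" if "k < n" for k using f that by (simp add: less_le)
  have ln: "ln (real_det M) = (\<Sum>k<n. ln (f k))"
    unfolding det by (intro ln_prod) (auto dest: f)
  have le: "ln (f k) \<le> f k - 1" if "k < n" for k using ln_le_minus_one f that by auto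
  have tr': "real_trace M - real n = (\<Sum>k<n. f k - 1)" by (simp add: tr sum_subtractf)
  show "ln (real_det M) \<le> real_trace M - real n"
    unfolding ln tr' using le by (intro sum_mono) auto
  assume "ln (real_det M) = real_trace M - real n"
  \<comment> \<open>A vanishing sum of nonnegative terms forces \<open>ln x = x - 1\<close> at every
    eigenvalue, which happens only at \<open>x = 1\<close>.\<close>
  hence "(\<Sum>k<n. (f k - 1) - ln (f k)) = 0" unfolding ln tr' by (simp add: sum_subtractf)
  hence "ln (f k) = f k - 1" if "k < n" for k
    using that le by (subst (asm) sum_nonneg_eq_0_iff) auto
  hence "f k = 1" if "k < n" for k using that f ln_eq_minus_one by auto
  hence "real_diag n f = 1\<^sub>m n" unfolding real_diag_one by (intro real_diag_cong)
  thus "M = 1\<^sub>m n" unfolding M using unitary_matD[OF V] by simp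
qed

lemma unitary_conj_mult:
  assumes "unitary_mat n V" "A \<in> carrier_mat n n" "B \<in> carrier_mat n n"
  shows "(V * A * mat_adjoint V) * (V * B * mat_adjoint V) = V * (A * B) * mat_adjoint V"
proof -
  note V = unitary_matD[OF assms(1)]
  have "(V * A * mat_adjoint V) * (V * B * mat_adjoint V)
      = V * (A * ((mat_adjoint V * V) * (B * mat_adjoint V)))"
    using V(1,2) assms by (simp add: assoc_mult_mat[of _ n n _ n _ n])
  also have "\<dots> = V * (A * B) * mat_adjoint V"
    unfolding V(3) using V(1,2) assms by (simp add: assoc_mult_mat[of _ n n _ n _ n])
  finally show ?thesis .
qed

lemma psd_sqrt_exists:
  assumes "psd_mat n A"
  shows "\<exists>B. psd_mat n B \<and> B * B = A"
proof -
  obtain V f where V: "unitary_mat n V" and f: "\<forall>k<n. f k \<ge> 0"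
    and A: "A = V * real_diag n f * mat_adjoint V"
    using psd_spectral[OF assms(1)] by blast
  let ?B = "V * real_diag n (\<lambda>k. sqrt (f k)) * mat_adjoint V"
  have "psd_mat n ?B"
    using f by (intro psd_mat_congruence[OF psd_mat_real_diag unitary_matD(1)[OF V]]) auto
  moreover have "?B * ?B = V * real_diag n (\<lambda>k. sqrt (f k) * sqrt (f k)) * mat_adjoint V"
    by (simp add: unitary_conj_mult[OF V])
  moreover have "real_diag n (\<lambda>k. sqrt (f k) * sqrt (f k)) = real_diag n f"
    using f by (intro real_diag_cong) auto
  ultimately show ?thesis using A by auto
qed

text \<open>With \<open>B\<close> the Hermitian square root of \<open>A\<close>, the diagonal entry
  is the squared norm of row \<open>k\<close> of \<open>B\<close>. If it vanishes, so do row and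
  column \<open>k\<close> of \<open>B\<close>, and hence those of \<open>A\<close>.\<close>

lemma psd_zero_diag_entry:
  assumes "psd_mat n A" "k < n" "Re (A $$ (k, k)) = 0" "j < n"
  shows "A $$ (k, j) = 0" and "A $$ (j, k) = 0"
proof -
  obtain B where B: "psd_mat n B" and A: "B * B = A" using psd_sqrt_exists[OF assms(1)] by blast
  have Bc: "B \<in> carrier_mat n n" and Bh: "mat_adjoint B = B" using B by (auto simp: psd_mat_def)
  have sym: "B $$ (i, k) = cnj (B $$ (k, i))" if "i < n" for i
    using index_mat_adjoint[of i B k] Bc Bh that assms by auto
  have "A $$ (k, k) = (\<Sum>i = 0..<n. B $$ (k, i) * cnj (B $$ (k, i)))"
    unfolding A[symmetric] using Bc assms by (auto simp: scalar_prod_def sym)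
  hence "(\<Sum>i = 0..<n. (cmod (B $$ (k, i)))\<^sup>2) = 0"
    using assms(3) by (simp add: complex_mult_cnj cmod_power2)
  hence "B $$ (k, i) = 0" if "i < n" for i
    using that by (subst (asm) sum_nonneg_eq_0_iff) auto
  thus "A $$ (k, j) = 0" "A $$ (j, k) = 0"
    unfolding A[symmetric] using Bc assms by (auto simp: scalar_prod_def sym)
qed

subsection \<open>The inverse square root\<close>

text \<open>In an eigenbasis of \<open>B - C\<close>, the diagonal of \<open>B (B - C) + (B - C) C = 0\<close> reads
  \<open>f\<^sub>k (b\<^sub>k\<^sub>k + c\<^sub>k\<^sub>k) = 0\<close> with \<open>f\<^sub>k = b\<^sub>k\<^sub>k - c\<^sub>k\<^sub>k\<close>.\<close>

lemma psd_sqrt_unique: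
  assumes B: "psd_mat n B" and C: "psd_mat n C" and eq: "B * B = C * C"
  shows "B = C"
proof -
  have Bc: "B \<in> carrier_mat n n" and Cc: "C \<in> carrier_mat n n"
    and h: "mat_adjoint B = B" "mat_adjoint C = C"
    using B C by (auto simp: psd_mat_def)
  have "mat_adjoint (B - C) = mat_adjoint B - mat_adjoint C"
    using Bc Cc by (intro eq_matI) auto
  moreover have "B - C \<in> carrier_mat n n" by (rule minus_carrier_mat[OF Cc])
  ultimately obtain V f where V: "unitary_mat n V" and T: "B - C = V * real_diag n f * mat_adjoint V"
    using hermitian_spectral[of "B - C" n] h by auto
  note V' = unitary_matD[OF V]
  define B' where "B' = mat_adjoint V * B * V"
  define C' where "C' = mat_adjoint V * C * V"
  have B': "psd_mat n B'" and C': "psd_mat n C'"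
    unfolding B'_def C'_def using psd_mat_congruence'[OF _ V'(1)] B C by auto
  hence B'c: "B' \<in> carrier_mat n n" and C'c: "C' \<in> carrier_mat n n" by (auto simp: psd_mat_def)
  have "B' - C' = mat_adjoint V * (B - C) * V"
    unfolding B'_def C'_def using V'(1,2) Bc Cc
    by (simp add: mult_minus_distrib_mat[of _ n n _ n] minus_mult_distrib_mat[of _ n n _ _ n])
  hence D: "B' - C' = real_diag n f" unfolding T by (simp add: unitary_conj_cancel'[OF V])
  have sq: "B' * B' = C' * C'"
    unfolding B'_def C'_def
    using unitary_conj_mult[OF unitary_mat_adjoint[OF V] Bc Bc]
      unitary_conj_mult[OF unitary_mat_adjoint[OF V] Cc Cc] eq by simp
  have "f k = 0" if k: "k < n" for k
  proof -
    have "B' * (B' - C') = B' * B' - B' * C'"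
      using B'c C'c by (simp add: mult_minus_distrib_mat[of _ n n _ n])
    moreover have "(B' - C') * C' = B' * C' - C' * C'"
      using B'c C'c by (simp add: minus_mult_distrib_mat[of _ n n _ _ n])
    ultimately have "(B' * real_diag n f) $$ (k, k) = - (real_diag n f * C') $$ (k, k)"
      unfolding D using B'c C'c k by (simp add: sq del: index_mult_mat(1))
    hence "B' $$ (k, k) * complex_of_real (f k) = - (complex_of_real (f k) * C' $$ (k, k))"
      using B'c C'c k by (simp add: index_real_diag_mult_left[of _ n n] index_real_diag_mult_right[of _ n n]
          del: index_mult_mat)
    hence 1: "f k * (Re (B' $$ (k, k)) + Re (C' $$ (k, k))) = 0"
      by (auto simp: complex_eq_iff algebra_simps)
    have "(B' - C') $$ (k, k) = complex_of_real (f k)" unfolding D using k by simp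
    hence 2: "f k = Re (B' $$ (k, k)) - Re (C' $$ (k, k))"
      using B'c C'c k by (auto simp: complex_eq_iff)
    \<comment> \<open>If the sum of the two nonnegative entries is zero, both are zero, and so is
      their difference \<open>f k\<close>.\<close>
    have "Re (B' $$ (k, k)) \<ge> 0" "Re (C' $$ (k, k)) \<ge> 0"
      using psd_mat_diag_entry B' C' k by auto
    thus "f k = 0" using 1 2 by (cases "f k = 0") auto
  qed
  hence "real_diag n f = 0\<^sub>m n n" by (intro eq_matI) auto
  hence "B - C = 0\<^sub>m n n" unfolding T using V'(1,2) by simp
  hence "(B - C) $$ (i, j) = 0" if "i < n" "j < n" for i j using that by simp
  thus "B = C" using Bc Cc by (intro eq_matI) auto
qed

lemma right_inverse_unique:
  fixes A X Y :: "complex mat"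
  assumes "A \<in> carrier_mat n n" "X \<in> carrier_mat n n" "Y \<in> carrier_mat n n"
    and "A * X = 1\<^sub>m n" "A * Y = 1\<^sub>m n"
  shows "X = Y"
proof -
  have "X * A = 1\<^sub>m n" using mat_mult_left_right_inverse assms by blast
  hence "Y = (X * A) * Y" using assms by simp
  also have "\<dots> = X * (A * Y)" using assms by (simp add: assoc_mult_mat[of _ n n _ n _ n])
  finally show ?thesis using assms by simp
qed

text \<open>The description in \<open>inv_sqrt_mat\<close> is met by the matrix with eigenvalues
  \<open>1 / sqrt (c + f k)\<close>. Any competitor has the same square, the unique right inverse of
  \<open>A\<close>, and positive semidefinite square roots are unique.\<close>

lemma inv_sqrt_mat_props:
  assumes R: "psd_mat n R" and c: "c > 0"
  defines "A \<equiv> complex_of_real c \<cdot>\<^sub>m 1\<^sub>m n + R"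
  shows "psd_mat n (inv_sqrt_mat A)" "A * (inv_sqrt_mat A * inv_sqrt_mat A) = 1\<^sub>m n"
proof -
  have A: "A \<in> carrier_mat n n" using R by (auto simp: A_def psd_mat_def)
  obtain V f where V: "unitary_mat n V" and f: "\<forall>k<n. f k \<ge> 0"
    and RV: "R = V * real_diag n f * mat_adjoint V"
    using psd_spectral[OF R] by blast
  have AV: "A = V * real_diag n (\<lambda>k. c + f k) * mat_adjoint V"
    unfolding A_def RV by (rule unitary_conj_add_smult_one[OF V])
  let ?B = "V * real_diag n (\<lambda>k. 1 / sqrt (c + f k)) * mat_adjoint V"
  have psd: "psd_mat n ?B"
    using f c by (intro psd_mat_congruence[OF psd_mat_real_diag unitary_matD(1)[OF V]]) auto
  have pos: "c + f k > 0" if "k < n" for k using f c that by (auto intro: add_pos_nonneg)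
  have "real_diag n (\<lambda>k. (c + f k) * (1 / sqrt (c + f k) * (1 / sqrt (c + f k)))) = real_diag n (\<lambda>k. 1)"
    by (intro real_diag_cong) (auto simp: less_imp_le dest: pos)
  hence "A * (?B * ?B) = 1\<^sub>m n"
    unfolding AV using unitary_matD[OF V]
    by (simp add: unitary_conj_mult[OF V] flip: real_diag_one)
  hence ex: "psd_mat n ?B \<and> A * (?B * ?B) = 1\<^sub>m n" using psd by simp
  have "\<exists>!B. psd_mat (dim_row A) B \<and> inverts_mat A (B * B)"
  proof (rule ex1I[of _ ?B])
    show "psd_mat (dim_row A) ?B \<and> inverts_mat A (?B * ?B)"
      using ex A by (auto simp: inverts_mat_def)
    fix B assume "psd_mat (dim_row A) B \<and> inverts_mat A (B * B)"
    hence B: "psd_mat n B" "A * (B * B) = 1\<^sub>m n" using A by (auto simp: inverts_mat_def)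
    have "B * B = ?B * ?B"
      using right_inverse_unique[OF A _ _ B(2)] ex B(1) by (auto simp: psd_mat_def)
    thus "B = ?B" using psd_sqrt_unique B(1) psd by blast
  qed
  from theI'[OF this] show "psd_mat n (inv_sqrt_mat A)" "A * (inv_sqrt_mat A * inv_sqrt_mat A) = 1\<^sub>m n"
    using A by (auto simp: inv_sqrt_mat_def inverts_mat_def)
qed

subsection \<open>Water-filling\<close>

text \<open>Concavity of the log-determinant, with the tangent taken at the diagonal matrix of the
  \<open>s\<^sub>k\<close>: with \<open>\<beta>\<^sub>k = 1 + s\<^sub>k d\<^sub>k\<close> and \<open>E = diag (sqrt d\<^sub>k)\<close>, apply \<open>ln det M \<le> tr M - n\<close> to
  \<open>M = C (I + E Y E) C\<close>, where \<open>C = diag (1 / sqrt \<beta>\<^sub>k)\<close>.\<close>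

lemma ln_det_tangent:
  assumes Y: "psd_mat n Y" and d: "\<And>k. k < n \<Longrightarrow> d k \<ge> 0" and s: "\<And>k. k < n \<Longrightarrow> s k \<ge> 0"
  defines "\<Delta> \<equiv> real_det (1\<^sub>m n + Y * real_diag n d)"
  shows "\<Delta> \<ge> 1"
    and "ln \<Delta> \<le> (\<Sum>k<n. ln (1 + s k * d k)) + (\<Sum>k<n. d k * (Re (Y $$ (k, k)) - s k) / (1 + s k * d k))"
    and "ln \<Delta> = (\<Sum>k<n. ln (1 + s k * d k)) + (\<Sum>k<n. d k * (Re (Y $$ (k, k)) - s k) / (1 + s k * d k)) \<Longrightarrow>
      i < n \<Longrightarrow> j < n \<Longrightarrow> d i > 0 \<Longrightarrow> d j > 0 \<Longrightarrow> Y $$ (i, j) = (if i = j then complex_of_real (s i) else 0)"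
proof -
  define \<beta> where "\<beta> k = 1 + s k * d k" for k
  have \<beta>: "\<beta> k > 0" if "k < n" for k using d s that by (auto simp: \<beta>_def intro: add_pos_nonneg)
  have Yc: "Y \<in> carrier_mat n n" using Y by (auto simp: psd_mat_def)
  define E where "E = real_diag n (\<lambda>k. sqrt (d k))"
  define C where "C = real_diag n (\<lambda>k. 1 / sqrt (\<beta> k))"
  have Ec: "E \<in> carrier_mat n n" "mat_adjoint E = E" and Cc: "C \<in> carrier_mat n n" "mat_adjoint C = C"
    by (auto simp: E_def C_def)
  define P where "P = E * Y * E"
  have P: "psd_mat n P" using psd_mat_congruence[OF Y Ec(1)] Ec by (simp add: P_def)
  have Pc: "P \<in> carrier_mat n n" using P by (auto simp: psd_mat_def)
  have EE: "E * E = real_diag n d"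
    unfolding E_def using d by (simp, intro real_diag_cong) auto
  \<comment> \<open>\<open>Y * real_diag n d\<close> need not be Hermitian; moving one factor
    \<open>E\<close> across yields the positive semidefinite \<open>P\<close> with the same
    determinant.\<close>
  have "det (1\<^sub>m n + Y * real_diag n d) = det (1\<^sub>m n + (Y * E) * E)"
    using Yc Ec by (simp add: EE[symmetric] assoc_mult_mat[of _ n n _ n _ n])
  also have "\<dots> = det (1\<^sub>m n + E * (Y * E))"
    using Yc Ec by (intro det_one_plus_mult_commute) auto
  also have "E * (Y * E) = P"
    using Yc Ec by (simp add: P_def assoc_mult_mat[of _ n n _ n _ n])
  finally have det1: "det (1\<^sub>m n + Y * real_diag n d) = det (1\<^sub>m n + P)" .
  obtain r where r: "r \<ge> 1" "det (1\<^sub>m n + P) = complex_of_real r"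
    using det_one_add_psd[OF P] by blast
  have \<Delta>: "\<Delta> = r" unfolding \<Delta>_def real_det_def det1 r by simp
  thus "\<Delta> \<ge> 1" using r by simp
  have psd1: "psd_mat n (1\<^sub>m n + P)"
    unfolding real_diag_one by (intro psd_mat_add P psd_mat_real_diag) auto
  define M where "M = C * (1\<^sub>m n + P) * C"
  have M: "psd_mat n M" using psd_mat_congruence[OF psd1 Cc(1)] Cc by (simp add: M_def)
  have "det M = det C * det C * det (1\<^sub>m n + P)"
    unfolding M_def using Cc Pc by (simp add: det_mult[of _ n])
  also have "det C * det C = complex_of_real ((\<Prod>k<n. 1 / sqrt (\<beta> k)) * (\<Prod>k<n. 1 / sqrt (\<beta> k)))"
    by (simp add: C_def det_real_diag del: of_real_prod)
  also have "(\<Prod>k<n. 1 / sqrt (\<beta> k)) * (\<Prod>k<n. 1 / sqrt (\<beta> k)) = (\<Prod>k<n. 1 / \<beta> k)"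
    unfolding prod.distrib[symmetric] using \<beta> by (intro prod.cong) (auto simp: less_imp_le)
  finally have detM: "real_det M = (\<Prod>k<n. 1 / \<beta> k) * r"
    by (simp add: real_det_def r del: of_real_prod flip: of_real_mult)
  have prodpos: "(\<Prod>k<n. 1 / \<beta> k) > 0" using \<beta> by (intro prod_pos) auto
  have detM_pos: "real_det M > 0" unfolding detM using prodpos r by simp
  have "ln (\<Prod>k<n. 1 / \<beta> k) = (\<Sum>k<n. ln (1 / \<beta> k))"
    by (intro ln_prod) (auto dest: \<beta>)
  also have "\<dots> = - (\<Sum>k<n. ln (\<beta> k))"
    unfolding sum_negf[symmetric] using \<beta> by (intro sum.cong) (auto simp: ln_div)
  finally have lnM: "ln (real_det M) = ln \<Delta> - (\<Sum>k<n. ln (\<beta> k))"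
    unfolding detM \<Delta> using ln_mult_pos[OF prodpos, of r] r(1) by linarith
  have Mij: "M $$ (i, j) = complex_of_real (1 / sqrt (\<beta> i)) *
      ((if i = j then 1 else 0) + complex_of_real (sqrt (d i)) * Y $$ (i, j) * complex_of_real (sqrt (d j)))
      * complex_of_real (1 / sqrt (\<beta> j))" if "i < n" "j < n" for i j
    unfolding M_def P_def C_def E_def using that Yc
    by (simp add: index_real_diag_mult_left[of _ n n] index_real_diag_mult_right[of _ n n]
       del: index_mult_mat(1))
  \<comment> \<open>Each diagonal entry contributes the derivative of
    \<open>ln (1 + x * d k)\<close> at \<open>x = s k\<close> times the displacement from
    \<open>s k\<close>.\<close>
  have tr1: "Re (M $$ (k, k)) - 1 = d k * (Re (Y $$ (k, k)) - s k) / \<beta> k" if k: "k < n" for k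
  proof -
    have "M $$ (k, k) = complex_of_real ((1 / sqrt (\<beta> k)) * (1 / sqrt (\<beta> k))) *
      (1 + complex_of_real (sqrt (d k) * sqrt (d k)) * Y $$ (k, k))"
      unfolding Mij[OF k k] by (simp only: if_True refl of_real_mult mult_ac)
    also have "(1 / sqrt (\<beta> k)) * (1 / sqrt (\<beta> k)) = 1 / \<beta> k" using \<beta>[OF k] by simp
    also have "sqrt (d k) * sqrt (d k) = d k" using d[OF k] by simp
    finally have "Re (M $$ (k, k)) = (1 + d k * Re (Y $$ (k, k))) / \<beta> k" by simp
    thus ?thesis using \<beta>[OF k] by (simp add: field_simps) (simp add: \<beta>_def algebra_simps)
  qed
  have tr: "real_trace M - real n = (\<Sum>k<n. d k * (Re (Y $$ (k, k)) - s k) / \<beta> k)"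
  proof -
    have "real_trace M = (\<Sum>k<n. Re (M $$ (k, k)))" using M by (auto simp: real_trace_def psd_mat_def)
    hence "real_trace M - real n = (\<Sum>k<n. Re (M $$ (k, k)) - 1)" by (simp add: sum_subtractf)
    thus ?thesis using tr1 by simp
  qed
  note le = ln_det_le_trace[OF M detM_pos, unfolded lnM tr]
  show "ln \<Delta> \<le> (\<Sum>k<n. ln (1 + s k * d k)) + (\<Sum>k<n. d k * (Re (Y $$ (k, k)) - s k) / (1 + s k * d k))"
    using le(1) by (simp add: \<beta>_def)
  assume "ln \<Delta> = (\<Sum>k<n. ln (1 + s k * d k)) + (\<Sum>k<n. d k * (Re (Y $$ (k, k)) - s k) / (1 + s k * d k))"
    and ij: "i < n" "j < n" "d i > 0" "d j > 0"
  \<comment> \<open>From \<open>M\<close> being the identity, the entry \<open>(i, j)\<close> of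
    \<open>Y\<close> can be recovered because \<open>sqrt (d i)\<close> and
    \<open>sqrt (d j)\<close> are both nonzero.\<close>
  hence "M = 1\<^sub>m n" using le(2) by (simp add: \<beta>_def)
  hence M1: "M $$ (i, j) = (if i = j then 1 else 0)" using ij by simp
  show "Y $$ (i, j) = (if i = j then complex_of_real (s i) else 0)"
  proof (cases "i = j")
    case True
    hence "d i * (Re (Y $$ (i, i)) - s i) / \<beta> i = 0" using tr1[OF ij(1)] M1 by simp
    hence "Re (Y $$ (i, i)) = s i" using ij \<beta>[OF ij(1)] by simp
    thus ?thesis using hermitian_diag_real[of Y n i] Y ij True by (auto simp: psd_mat_def)
  next
    case False
    thus ?thesis using Mij[OF ij(1,2)] M1 ij \<beta>[OF ij(1)] \<beta>[OF ij(2)] by simp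
  qed
qed

text \<open>First-order optimality: the slope of \<open>W * log 2 (1 + x * d)\<close> at
  \<open>x = s\<close> equals \<open>l / \<eta>\<close> when \<open>s > 0\<close>, giving equality.
  Otherwise \<open>s = 0\<close>, the slope is at most \<open>l / \<eta>\<close>, and
  \<open>y - s \<ge> 0\<close>.\<close>

lemma water_level_optimal:
  fixes W \<eta> l d y :: real
  assumes "W > 0" "\<eta> > 0" "l > 0" "d > 0" "y \<ge> 0"
  defines "s \<equiv> max (W * \<eta> / (l * ln 2) - 1 / d) 0"
  shows "W / ln 2 * (d * (y - s) / (1 + s * d)) \<le> l / \<eta> * (y - s)"
proof (cases "W * \<eta> / (l * ln 2) - 1 / d > 0")
  case True
  hence "s = W * \<eta> / (l * ln 2) - 1 / d" by (simp add: s_def)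
  hence level: "1 + s * d = W * \<eta> * d / (l * ln 2)" using assms(1-4) by (simp add: field_simps)
  have "W / ln 2 * (d * (y - s) / (1 + s * d)) = l / \<eta> * (y - s)"
    unfolding level using assms(1-4) by (simp add: field_simps)
  thus ?thesis by simp
next
  case False
  hence s: "s = 0" by (simp add: s_def)
  have "W * \<eta> / (l * ln 2) \<le> 1 / d" using False by simp
  hence "W / ln 2 * d \<le> l / \<eta>" using assms(1-4) by (simp add: field_simps)
  hence "W / ln 2 * d * y \<le> l / \<eta> * y" using assms(5) by (rule mult_right_mono)
  thus ?thesis using s by (simp add: mult_ac)
qed

text \<open>\<open>vmax - v\<close> is a sum of two nonnegative gaps: the slack of the tangent bound
  and the first-order slacks \<open>g k\<close>. The maximizer is the matrix at which both
  vanish.\<close>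

lemma water_filling:
  fixes G U X :: "complex mat" and d s :: "nat \<Rightarrow> real"
  assumes pos: "W > 0" "\<eta> > 0" "l > 0"
    and G: "G \<in> carrier_mat N M" and U: "unitary_mat N U"
    and GU: "G * mat_adjoint G = U * real_diag N d * mat_adjoint U"
    and d: "\<And>k. k < N \<Longrightarrow> d k \<ge> 0"
    and s: "\<And>k. k < N \<Longrightarrow> s k = (if d k > 0 then max (W * \<eta> / (l * ln 2) - 1 / d k) 0 else 0)"
    and X: "psd_mat N X"
  defines "v \<equiv> W * log 2 (real_det (1\<^sub>m M + mat_adjoint G * X * G)) - l * (real_trace X / \<eta>)"
    and "vmax \<equiv> W * (\<Sum>k<N. log 2 (1 + s k * d k)) - l * (1 / \<eta> * (\<Sum>k<N. s k))"
  shows "v \<le> vmax" and "v = vmax \<longleftrightarrow> X = U * real_diag N s * mat_adjoint U"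
proof -
  note U' = unitary_matD[OF U]
  have Xc: "X \<in> carrier_mat N N" using X by (auto simp: psd_mat_def)
  have s0: "s k \<ge> 0" if "k < N" for k using s[OF that] by auto
  define Y where "Y = mat_adjoint U * X * U"
  have Y: "psd_mat N Y" unfolding Y_def by (rule psd_mat_congruence'[OF X U'(1)])
  have Yc: "Y \<in> carrier_mat N N" using Y by (auto simp: psd_mat_def)
  have XY: "X = U * Y * mat_adjoint U" unfolding Y_def using unitary_conj_cancel[OF U Xc] by simp
  \<comment> \<open>Exchanging factors twice, first for \<open>G\<close> and then for
    \<open>U\<close>, replaces a determinant of size \<open>M\<close> by one of size
    \<open>N\<close> in the rotated variable \<open>Y\<close>.\<close>
  have "det (1\<^sub>m M + mat_adjoint G * X * G) = det (1\<^sub>m M + mat_adjoint G * (X * G))"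
    using G Xc by (simp add: assoc_mult_mat[of _ M N _ N _ M])
  also have "\<dots> = det (1\<^sub>m N + (X * G) * mat_adjoint G)"
    using G Xc by (intro det_one_plus_mult_commute) auto
  also have "(X * G) * mat_adjoint G = X * (G * mat_adjoint G)"
    using G Xc by (simp add: assoc_mult_mat[of _ N N _ M _ N])
  also have "\<dots> = U * (Y * real_diag N d) * mat_adjoint U"
    unfolding GU XY using Yc by (simp add: unitary_conj_mult[OF U])
  also have "\<dots> = U * (Y * real_diag N d * mat_adjoint U)"
    using U'(1,2) Yc by (simp add: assoc_mult_mat[of _ N N _ N _ N])
  also have "det (1\<^sub>m N + \<dots>) = det (1\<^sub>m N + (Y * real_diag N d * mat_adjoint U) * U)"
    using U'(1,2) Yc by (intro det_one_plus_mult_commute) auto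
  also have "(Y * real_diag N d * mat_adjoint U) * U = Y * real_diag N d * (mat_adjoint U * U)"
    using U'(1,2) Yc by (simp add: assoc_mult_mat[of _ N N _ N _ N])
  also have "\<dots> = Y * real_diag N d" unfolding U'(3) using Yc by simp
  finally have det: "real_det (1\<^sub>m M + mat_adjoint G * X * G) = real_det (1\<^sub>m N + Y * real_diag N d)"
    by (simp add: real_det_def)
  have "real_trace X = real_trace Y" unfolding XY by (rule real_trace_unitary_conj[OF U Yc])
  also have "\<dots> = (\<Sum>k<N. Re (Y $$ (k, k)))" using Yc by (simp add: real_trace_def)
  finally have tr: "real_trace X = (\<Sum>k<N. Re (Y $$ (k, k)))" .
  define y where "y k = Re (Y $$ (k, k))" for k
  define \<Delta> where "\<Delta> = real_det (1\<^sub>m N + Y * real_diag N d)"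
  define S where "S = (\<Sum>k<N. ln (1 + s k * d k))"
  define T where "T = (\<Sum>k<N. d k * (y k - s k) / (1 + s k * d k))"
  have v: "v = W / ln 2 * ln \<Delta> - l / \<eta> * (\<Sum>k<N. y k)"
    unfolding v_def det \<Delta>_def tr y_def by (simp add: log_def)
  have vmax: "vmax = W / ln 2 * S - l / \<eta> * (\<Sum>k<N. s k)"
    unfolding vmax_def S_def by (simp add: log_def flip: sum_divide_distrib)
  have tangent: "ln \<Delta> \<le> S + T"
    unfolding \<Delta>_def S_def T_def y_def using ln_det_tangent(2)[OF Y d s0] by simp
  define g where "g k = l / \<eta> * (y k - s k) - W / ln 2 * (d k * (y k - s k) / (1 + s k * d k))" for k
  have y0: "y k \<ge> 0" if "k < N" for k unfolding y_def by (rule psd_mat_diag_entry[OF Y that])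
  have g0: "g k \<ge> 0" if k: "k < N" for k
  proof (cases "d k > 0")
    case True
    thus ?thesis using water_level_optimal[OF pos True y0[OF k]] s[OF k] by (simp add: g_def)
  next
    case False
    \<comment> \<open>Without gain no power is allotted, so \<open>g k\<close> is just the cost
      \<open>l / \<eta> * y k\<close>.\<close>
    hence "d k = 0" using d[OF k] by simp
    thus ?thesis using s[OF k] y0[OF k] pos by (simp add: g_def)
  qed
  have "(\<Sum>k<N. g k) = l / \<eta> * (\<Sum>k<N. y k) - l / \<eta> * (\<Sum>k<N. s k) - W / ln 2 * T"
    by (simp add: g_def T_def sum_subtractf sum_distrib_left right_diff_distrib)
  hence gap: "vmax - v = W / ln 2 * (S + T - ln \<Delta>) + (\<Sum>k<N. g k)"
    unfolding v vmax by (simp add: distrib_left right_diff_distrib del: times_divide_eq_left)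
  have gap1: "W / ln 2 * (S + T - ln \<Delta>) \<ge> 0" using tangent pos by (intro mult_nonneg_nonneg) auto
  have gap2: "(\<Sum>k<N. g k) \<ge> 0" using g0 by (intro sum_nonneg) auto
  show "v \<le> vmax" using gap gap1 gap2 by linarith
  show "v = vmax \<longleftrightarrow> X = U * real_diag N s * mat_adjoint U"
  proof
    assume "v = vmax"
    hence "W / ln 2 * (S + T - ln \<Delta>) = 0" and g: "(\<Sum>k<N. g k) = 0" using gap gap1 gap2 by linarith+
    hence eq: "ln \<Delta> = S + T" using pos by simp
    have g: "g k = 0" if "k < N" for k using g g0 that by (subst (asm) sum_nonneg_eq_0_iff) auto
    have "Y = real_diag N s"
    proof (rule eq_matI)
      fix i j assume "i < dim_row (real_diag N s)" "j < dim_col (real_diag N s)"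
      hence ij: "i < N" "j < N" by auto
      \<comment> \<open>Equality in the tangent bound says nothing about directions without gain.
        There the vanishing cost makes the diagonal entry zero, and semidefiniteness then clears its
        row and column.\<close>
      have zero: "Re (Y $$ (k, k)) = 0 \<and> s k = 0" if "k < N" "\<not> d k > 0" for k
      proof -
        have "d k = 0" "s k = 0" using d[OF that(1)] s[OF that(1)] that(2) by auto
        thus ?thesis using g[OF that(1)] pos by (simp add: g_def y_def)
      qed
      show "Y $$ (i, j) = real_diag N s $$ (i, j)"
      proof (cases "d i > 0 \<and> d j > 0")
        case True
        thus ?thesis using ln_det_tangent(3)[where d = d and s = s, OF Y d s0 _ ij] eq ij
          by (simp add: \<Delta>_def S_def T_def y_def)
      next
        case False
        hence "Y $$ (i, j) = 0"
          using zero ij psd_zero_diag_entry[OF Y] by blast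
        thus ?thesis using False zero ij by auto
      qed
    qed (use Yc in auto)
    thus "X = U * real_diag N s * mat_adjoint U" using XY by simp
  next
    assume "X = U * real_diag N s * mat_adjoint U"
    \<comment> \<open>For diagonal \<open>Y\<close> the determinant is the product whose logarithm
      is \<open>S\<close>, and both gaps vanish.\<close>
    hence YS: "Y = real_diag N s" unfolding Y_def by (simp add: unitary_conj_cancel'[OF U])
    have pos': "1 + s k * d k > 0" if "k < N" for k
      using d s0 that by (auto intro: add_pos_nonneg)
    have ys: "y k = s k" if "k < N" for k using that by (simp add: y_def YS)
    have "1\<^sub>m N + Y * real_diag N d = real_diag N (\<lambda>k. 1 + s k * d k)"
      unfolding YS by (simp add: real_diag_one real_diag_add)
    hence "\<Delta> = (\<Prod>k<N. 1 + s k * d k)"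
      by (simp add: \<Delta>_def real_det_def det_real_diag del: of_real_prod)
    hence "ln \<Delta> = S" unfolding S_def by (simp, intro ln_prod) (auto dest: pos')
    moreover have "T = 0" unfolding T_def using ys by simp
    moreover have "(\<Sum>k<N. g k) = 0" using ys by (simp add: g_def)
    ultimately show "v = vmax" using gap by simp
  qed
qed

subsection \<open>The root of \<open>\<Phi>\<close> and the energy efficiency\<close>

lemma rx_cov_carrier [simp]: "rx_cov M H Q J \<in> carrier_mat M M"
  by (simp add: rx_cov_def)

lemma rx_cov_insert:
  assumes "finite J" "j \<notin> J" "H j \<in> carrier_mat N M" "Q j \<in> carrier_mat N N"
  shows "rx_cov M H Q (insert j J) = mat_adjoint (H j) * Q j * H j + rx_cov M H Q J"
  using assms by (intro eq_matI) (auto simp: rx_cov_def simp del: index_mult_mat(1))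

lemma rx_cov_cong:
  "(\<And>j. j \<in> J \<Longrightarrow> Q j = Q' j) \<Longrightarrow> rx_cov M H Q J = rx_cov M H Q' J"
  by (simp add: rx_cov_def)

lemma psd_rx_cov:
  assumes "finite J" "\<And>j. j \<in> J \<Longrightarrow> H j \<in> carrier_mat N M" "\<And>j. j \<in> J \<Longrightarrow> psd_mat N (Q j)"
  shows "psd_mat M (rx_cov M H Q J)"
  using assms
proof (induction J rule: finite_induct)
  case empty
  have "rx_cov M H Q {} = real_diag M (\<lambda>_. 0)"
    by (intro eq_matI) (auto simp: rx_cov_def)
  thus ?case using psd_mat_real_diag[of M "\<lambda>_. 0"] by simp
next
  case (insert j J)
  have "Q j \<in> carrier_mat N N" using insert.prems by (auto simp: psd_mat_def)
  hence "rx_cov M H Q (insert j J) = mat_adjoint (H j) * Q j * H j + rx_cov M H Q J"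
    using insert by (intro rx_cov_insert) auto
  thus ?case using insert by (auto intro!: psd_mat_add psd_mat_congruence')
qed

text \<open>With \<open>A\<close>, its inverse square root \<open>B\<close> and the signal part
  \<open>Z\<close>, the matrix \<open>c I + Z + R\<close> factors as \<open>A (I + B B Z)\<close>.
  Exchanging a factor \<open>B\<close> turns the second determinant into that of
  \<open>I + B Z B\<close>, the whitened channel.\<close>

lemma log_det_whitening:
  fixes H X R :: "complex mat"
  assumes H: "H \<in> carrier_mat N M" and X: "psd_mat N X" and R: "psd_mat M R" and c: "c > 0"
  defines "G \<equiv> H * inv_sqrt_mat (complex_of_real c \<cdot>\<^sub>m 1\<^sub>m M + R)"
  shows "log 2 (real_det (1\<^sub>m M + complex_of_real (1 / c) \<cdot>\<^sub>m (mat_adjoint H * X * H + R)))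
    = log 2 (real_det (1\<^sub>m M + complex_of_real (1 / c) \<cdot>\<^sub>m R))
      + log 2 (real_det (1\<^sub>m M + mat_adjoint G * X * G))"
proof -
  define A where "A = complex_of_real c \<cdot>\<^sub>m 1\<^sub>m M + R"
  define B where "B = inv_sqrt_mat A"
  define Z where "Z = mat_adjoint H * X * H"
  have Xc: "X \<in> carrier_mat N N" and Rc: "R \<in> carrier_mat M M" using X R by (auto simp: psd_mat_def)
  have A: "A \<in> carrier_mat M M" using Rc by (auto simp: A_def)
  have B: "B \<in> carrier_mat M M" "mat_adjoint B = B" "A * (B * B) = 1\<^sub>m M"
    using inv_sqrt_mat_props[OF R c] by (auto simp: A_def B_def psd_mat_def)
  have Z: "Z \<in> carrier_mat M M" using H Xc by (auto simp: Z_def)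
  have G: "G = H * B" by (simp add: G_def A_def B_def)
  have Gc: "G \<in> carrier_mat N M" using H B by (auto simp: G)
  have "mat_adjoint G = B * mat_adjoint H"
    unfolding G using H B by (simp add: mat_adjoint_mult[of _ N M _ M])
  hence GXG: "mat_adjoint G * X * G = B * (Z * B)"
    unfolding G Z_def using H Xc B
    by (simp add: assoc_mult_mat[of _ M M _ N _ M] assoc_mult_mat[of _ M M _ N _ N]
       assoc_mult_mat[of _ M N _ N _ M] assoc_mult_mat[of _ M N _ M _ M] assoc_mult_mat[of _ N N _ M _ M]
       mult_carrier_mat[of _ M N _ M] mult_carrier_mat[of _ M N _ N] mult_carrier_mat[of _ N N _ M])
  \<comment> \<open>The noise normalisation is pulled out to expose \<open>A\<close>, and put back
    into \<open>A\<close> after the factorisation.\<close>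
  have scale: "1\<^sub>m M + complex_of_real (1 / c) \<cdot>\<^sub>m T = complex_of_real (1 / c) \<cdot>\<^sub>m (complex_of_real c \<cdot>\<^sub>m 1\<^sub>m M + T)"
    if "T \<in> carrier_mat M M" for T
    using that c by (intro eq_matI) (auto simp: field_simps)
  have "A * (1\<^sub>m M + (B * B) * Z) = A + A * ((B * B) * Z)"
    using A B(1) Z by (simp add: mult_add_distrib_mat[of _ M M _ M])
  also have "A * ((B * B) * Z) = (A * (B * B)) * Z"
    using A B(1) Z by (simp add: assoc_mult_mat[of _ M M _ M _ M])
  also have "A + (A * (B * B)) * Z = complex_of_real c \<cdot>\<^sub>m 1\<^sub>m M + (Z + R)"
    unfolding B(3) using Z Rc by (intro eq_matI) (auto simp: A_def)
  finally have AZ: "complex_of_real c \<cdot>\<^sub>m 1\<^sub>m M + (Z + R) = A * (1\<^sub>m M + (B * B) * Z)" by simp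
  have "det (1\<^sub>m M + (B * B) * Z) = det (1\<^sub>m M + B * (B * Z))"
    using B(1) Z by (simp add: assoc_mult_mat[of _ M M _ M _ M])
  also have "\<dots> = det (1\<^sub>m M + (B * Z) * B)"
    using B(1) Z by (intro det_one_plus_mult_commute) auto
  also have "(B * Z) * B = mat_adjoint G * X * G"
    unfolding GXG using B(1) Z by (simp add: assoc_mult_mat[of _ M M _ M _ M])
  finally have detG: "det (1\<^sub>m M + (B * B) * Z) = det (1\<^sub>m M + mat_adjoint G * X * G)" .
  have "1\<^sub>m M + complex_of_real (1 / c) \<cdot>\<^sub>m (Z + R) = complex_of_real (1 / c) \<cdot>\<^sub>m (A * (1\<^sub>m M + (B * B) * Z))"
    using scale[of "Z + R"] Z Rc AZ by simp
  also have "\<dots> = (complex_of_real (1 / c) \<cdot>\<^sub>m A) * (1\<^sub>m M + (B * B) * Z)"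
    using A B(1) Z by (simp add: mult_smult_assoc_mat[of _ M M _ M])
  also have "complex_of_real (1 / c) \<cdot>\<^sub>m A = 1\<^sub>m M + complex_of_real (1 / c) \<cdot>\<^sub>m R"
    unfolding A_def using scale[OF Rc] by simp
  finally have factor: "1\<^sub>m M + complex_of_real (1 / c) \<cdot>\<^sub>m (Z + R)
      = (1\<^sub>m M + complex_of_real (1 / c) \<cdot>\<^sub>m R) * (1\<^sub>m M + (B * B) * Z)" .
  have "det (1\<^sub>m M + complex_of_real (1 / c) \<cdot>\<^sub>m (Z + R))
      = det (1\<^sub>m M + complex_of_real (1 / c) \<cdot>\<^sub>m R) * det (1\<^sub>m M + mat_adjoint G * X * G)"
    unfolding factor detG[symmetric] using Rc B(1) Z by (intro det_mult[of _ M]) auto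
  \<comment> \<open>Both determinants are real and at least 1, so the real part is multiplicative
    and the logarithm splits.\<close>
  moreover obtain r where "r \<ge> 1" "det (1\<^sub>m M + complex_of_real (1 / c) \<cdot>\<^sub>m R) = complex_of_real r"
    using det_one_add_psd[OF psd_mat_smult[OF R, of "1 / c"]] c by auto
  moreover obtain q where "q \<ge> 1" "det (1\<^sub>m M + mat_adjoint G * X * G) = complex_of_real q"
    using det_one_add_psd[OF psd_mat_congruence'[OF X Gc]] by auto
  ultimately show ?thesis
    unfolding Z_def[symmetric] by (simp add: real_det_def log_mult)
qed

section \<open>The optimal value as a function of the price \<open>l\<close>, and its zero\<close>

lemma water_level_value:
  fixes W \<eta> l d y :: real
  assumes pos: "W > 0" "\<eta> > 0" "l > 0" "d > 0" "y \<ge> 0"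
  defines "s \<equiv> max (W * \<eta> / (l * ln 2) - 1 / d) 0"
  shows "W * log 2 (1 + y * d) - l / \<eta> * y \<le> W * log 2 (1 + s * d) - l / \<eta> * s"
proof -
  have "s \<ge> 0" by (simp add: s_def)
  hence sp: "1 + s * d > 0" and yp: "1 + y * d > 0" using pos by (auto intro: add_pos_nonneg)
  \<comment> \<open>By concavity the tangent of \<open>ln\<close> at \<open>1 + s * d\<close> bounds
    the gain; first-order optimality compares it with the cost.\<close>
  have "ln (1 + y * d) - ln (1 + s * d) = ln ((1 + y * d) / (1 + s * d))"
    using sp yp by (simp add: ln_div)
  also have "\<dots> \<le> (1 + y * d) / (1 + s * d) - 1" using sp yp by (intro ln_le_minus_one) simp
  also have "\<dots> = d * (y - s) / (1 + s * d)" using sp by (simp add: field_simps)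
  finally have "W / ln 2 * (ln (1 + y * d) - ln (1 + s * d)) \<le> W / ln 2 * (d * (y - s) / (1 + s * d))"
    using pos by (intro mult_left_mono) auto
  also have "\<dots> \<le> l / \<eta> * (y - s)" unfolding s_def by (rule water_level_optimal[OF pos])
  finally show ?thesis by (simp add: log_def diff_divide_distrib right_diff_distrib)
qed

text \<open>\<open>g l k\<close> is the maximum over \<open>y \<ge> 0\<close> of a value
  nonincreasing in the price \<open>l\<close>, so it is nonincreasing too; the term
  \<open>- l * a\<close> makes \<open>\<Phi>\<close> strictly decreasing. Positivity of
  \<open>l\<close> belongs to the claim: division by zero gives \<open>\<Phi> 0 = b\<close>, which
  may be 0.\<close>

lemma water_filling_root:
  fixes W \<eta> a b :: real and d :: "nat \<Rightarrow> real" and \<Phi> :: "real \<Rightarrow> real"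
  assumes pos: "W > 0" "\<eta> > 0" "a > 0" and b: "b \<ge> 0" and L: "1 \<le> L"
    and d: "\<And>k. k < L \<Longrightarrow> d k > 0"
    and \<Phi>: "\<And>l. \<Phi> l =
          b + W * (\<Sum>k<L. log 2 (1 + max (W * \<eta> / (l * ln 2) - 1 / d k) 0 * d k))
            - l * (1 / \<eta> * (\<Sum>k<L. max (W * \<eta> / (l * ln 2) - 1 / d k) 0) + a)"
  shows "\<exists>!l. l > 0 \<and> \<Phi> l = 0"
proof -
  define s where "s l k = max (W * \<eta> / (l * ln 2) - 1 / d k) 0" for l k
  define g where "g l k = W * log 2 (1 + s l k * d k) - l / \<eta> * s l k" for l k
  have \<Phi>_g: "\<Phi> l = b + (\<Sum>k<L. g l k) - l * a" for l
    unfolding \<Phi> g_def s_def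
    by (simp add: sum_subtractf sum_distrib_left distrib_left mult.assoc)
  have g_ge: "g l k \<ge> W * log 2 (1 + y * d k) - l / \<eta> * y" if "l > 0" "k < L" "y \<ge> 0" for l k y
    unfolding g_def s_def using water_level_value[OF pos(1,2) that(1) d[OF that(2)] that(3)] .
  have g_dec: "g l' k \<le> g l k" if "0 < l" "l \<le> l'" "k < L" for l l' k
  proof -
    have s: "s l' k \<ge> 0" by (simp add: s_def)
    \<comment> \<open>The level optimal at \<open>l'\<close> remains admissible at the lower price
      \<open>l\<close>, where it costs no more.\<close>
    have "l / \<eta> * s l' k \<le> l' / \<eta> * s l' k"
      using that pos s by (intro mult_right_mono divide_right_mono) auto
    hence "g l' k \<le> W * log 2 (1 + s l' k * d k) - l / \<eta> * s l' k" by (simp add: g_def)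
    also have "\<dots> \<le> g l k" by (rule g_ge[OF that(1,3) s])
    finally show ?thesis .
  qed
  have \<Phi>_dec: "\<Phi> l' \<le> \<Phi> l - (l' - l) * a" if "0 < l" "l \<le> l'" for l l'
  proof -
    have "(\<Sum>k<L. g l' k) \<le> (\<Sum>k<L. g l k)" using g_dec that by (intro sum_mono) auto
    thus ?thesis by (simp add: \<Phi>_g left_diff_distrib)
  qed
  have \<Phi>_strict: "\<Phi> l' < \<Phi> l" if "0 < l" "l < l'" for l l'
  proof -
    have "(l' - l) * a > 0" using that pos by simp
    thus ?thesis using \<Phi>_dec[of l l'] that by linarith
  qed
  \<comment> \<open>\<open>w\<close> is the rate of unit power on channel 0 and \<open>D\<close> the
    total power then spent, so \<open>\<Phi> l \<ge> w - l * D\<close> for positive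
    \<open>l\<close>. The choice of \<open>l0\<close> makes this bound \<open>w / 2\<close>.\<close>
  define w where "w = W * log 2 (1 + d 0)"
  have w: "w > 0" using pos d[of 0] L by (auto simp: w_def)
  define D where "D = 1 / \<eta> + a"
  have den: "D > 0" using pos by (simp add: D_def add_pos_pos)
  define l0 where "l0 = w / (2 * D)"
  have l0: "l0 > 0" using w den by (simp add: l0_def)
  have "\<Phi> l0 > 0"
  proof -
    have "g l0 k \<ge> 0" if "k < L" for k using g_ge[OF l0 that, of 0] by simp
    hence "g l0 0 \<le> (\<Sum>k<L. g l0 k)"
      using L by (intro member_le_sum) auto
    moreover have "w - l0 / \<eta> \<le> g l0 0" using g_ge[OF l0, of 0 1] L by (simp add: w_def)
    moreover have "l0 / \<eta> + l0 * a = l0 * D" by (simp add: D_def distrib_left)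
    moreover have "l0 * D = w / 2" using den by (simp add: l0_def)
    ultimately show ?thesis using b w unfolding \<Phi>_g by linarith
  qed
  \<comment> \<open>From 1 onwards \<open>\<Phi>\<close> falls at rate at least \<open>a\<close>, so
    it is nonpositive once \<open>(l1 - 1) * a \<ge> \<Phi> 1\<close>.\<close>
  define l1 where "l1 = max 1 ((\<Phi> 1 + a) / a)"
  have l1: "l1 \<ge> 1" by (simp add: l1_def)
  have "(\<Phi> 1 + a) / a \<le> l1" by (simp add: l1_def)
  hence "\<Phi> 1 + a \<le> l1 * a" using pos by (simp add: pos_divide_le_eq)
  hence \<Phi>l1: "\<Phi> l1 \<le> 0" using \<Phi>_dec[of 1 l1] l1 by (simp add: left_diff_distrib)
  \<comment> \<open>The formulas do not order the two points; the signs of \<open>\<Phi>\<close> and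
    its monotonicity do.\<close>
  have le: "l0 \<le> l1"
  proof (rule ccontr)
    assume "\<not> l0 \<le> l1"
    hence "\<Phi> l0 < \<Phi> l1" using \<Phi>_strict[of l1 l0] l1 by simp
    thus False using \<open>\<Phi> l0 > 0\<close> \<Phi>l1 by simp
  qed
  \<comment> \<open>The interval stays away from 0, where the division by \<open>l\<close> would
    break continuity.\<close>
  have cont_s: "continuous_on {l0..l1} (\<lambda>l. s l k)" for k
    unfolding s_def using l0 by (intro continuous_intros) auto
  have "1 + s l k * d k > 0" if "k < L" for l k
    using d[OF that] by (intro add_pos_nonneg) (auto simp: s_def)
  hence "continuous_on {l0..l1} (\<lambda>l. g l k)" if "k < L" for k
    unfolding g_def log_def using that \<open>\<eta> > 0\<close>
    by (intro continuous_intros cont_s) (simp_all add: less_imp_neq[symmetric])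
  hence "continuous_on {l0..l1} (\<lambda>l. b + (\<Sum>k<L. g l k) - l * a)"
    by (intro continuous_intros) simp
  hence "continuous_on {l0..l1} \<Phi>" by (simp add: \<Phi>_g[abs_def])
  then obtain l where l: "l0 \<le> l" "\<Phi> l = 0"
    using IVT2'[of \<Phi> l1 0 l0] \<open>\<Phi> l0 > 0\<close> \<Phi>l1 le by auto
  show ?thesis
  proof (rule ex1I[of _ l])
    show "l > 0 \<and> \<Phi> l = 0" using l l0 by simp
    fix l' assume l': "l' > 0 \<and> \<Phi> l' = 0"
    show "l' = l"
      using \<Phi>_strict[of l l'] \<Phi>_strict[of l' l] l l0 l' by (cases l l' rule: linorder_cases) auto
  qed
qed

section \<open>Maximizers of the energy efficiency\<close>

lemma is_arg_max_iff_unique: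
  fixes f :: "'a \<Rightarrow> real"
  assumes "P x" "\<And>y. P y \<Longrightarrow> f y \<le> m" "\<And>y. P y \<Longrightarrow> f y = m \<longleftrightarrow> y = x"
  shows "is_arg_max f P y \<longleftrightarrow> y = x"
  using assms unfolding is_arg_max_def by (metis not_less order_less_le)

text \<open>The eigendecomposition is that of \<open>G * mat_adjoint G\<close>, of size
  \<open>N\<close>, so that conjugating the diagonal powers by \<open>U\<close> yields a transmit
  covariance. The factor \<open>W\<close> in the level comes from equating the derivative of
  \<open>W * log 2 (1 + d k * x)\<close> with \<open>l / \<eta>\<close>; with \<open>W\<close> on
  the rate sum, \<open>\<Phi> l\<close> is the optimal value at \<open>l\<close>. Each equivalence
  with \<open>is_arg_max\<close> states optimality and uniqueness at once.\<close>

theorem mainTheorem2: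
  fixes K N Ma L i :: nat
    and W noise \<eta> Pdyn Psta Pc a b :: real
    and H Q :: "nat \<Rightarrow> complex mat"
    and G U :: "complex mat"
    and d :: "nat \<Rightarrow> real"
    and s :: "real \<Rightarrow> nat \<Rightarrow> real"
    and rate :: "complex mat \<Rightarrow> real"
    and EE EE' :: "complex mat \<Rightarrow> real"
    and \<Phi> :: "real \<Rightarrow> real"
  assumes "K \<ge> 1" and "N \<ge> 1" and "Ma \<ge> 1"
    and "W > 0" and "noise > 0" and "\<eta> > 0"
    and "Pc = real Ma * Pdyn + Psta" and "Pc > 0"
    and "\<And>j. j \<in> {1..K} \<Longrightarrow> H j \<in> carrier_mat N Ma"
    and "i \<in> {1..K}"
    and "\<And>j. j \<in> {1..K} - {i} \<Longrightarrow> psd_mat N (Q j)"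
    and "a = total_power \<eta> Pc Q ({1..K} - {i})"
    and "b = sum_rate W noise Ma H Q ({1..K} - {i})"
    and "G = H i * inv_sqrt_mat (complex_of_real noise \<cdot>\<^sub>m 1\<^sub>m Ma + rx_cov Ma H Q ({1..K} - {i}))"
    and "unitary_mat N U"
    and "G * mat_adjoint G = U * real_diag N d * mat_adjoint U"
    and "1 \<le> L" and "L \<le> N"
    and "\<And>k. k < L \<Longrightarrow> d k > 0"
    and "\<And>k. L \<le> k \<Longrightarrow> k < N \<Longrightarrow> d k = 0"
    and s: "\<And>l k. s l k = (if k < L then max (W * \<eta> / (l * ln 2) - 1 / d k) 0 else 0)"
    and rate: "\<And>X. rate X = b + W * log 2 (real_det (1\<^sub>m Ma + mat_adjoint G * X * G))"
    and EE: "\<And>X. EE X = sum_rate W noise Ma H (Q(i := X)) {1..K}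
                          / total_power \<eta> Pc (Q(i := X)) {1..K}"
    and EE': "\<And>X. EE' X = rate X / (real_trace X / \<eta> + a)"
    and \<Phi>: "\<And>l. \<Phi> l =
          b + W * (\<Sum>k<L. log 2 (1 + max (W * \<eta> / (l * ln 2) - 1 / d k) 0 * d k))
            - l * (1 / \<eta> * (\<Sum>k<L. max (W * \<eta> / (l * ln 2) - 1 / d k) 0) + a)"
  shows "(\<forall>l > 0. \<forall>X.
            is_arg_max (\<lambda>X. rate X - l * (real_trace X / \<eta> + a)) (psd_mat N) X
              \<longleftrightarrow> X = U * real_diag N (s l) * mat_adjoint U)
       \<and> (\<forall>X. psd_mat N X \<longrightarrow> EE X = EE' X)
       \<and> (\<exists>!l. l > 0 \<and> \<Phi> l = 0)
       \<and> (\<forall>l. l > 0 \<and> \<Phi> l = 0 \<longrightarrow>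
            (\<forall>X. is_arg_max EE (psd_mat N) X \<longleftrightarrow> X = U * real_diag N (s l) * mat_adjoint U)
          \<and> (\<forall>X. is_arg_max EE' (psd_mat N) X \<longleftrightarrow> X = U * real_diag N (s l) * mat_adjoint U))"
proof -
  note W = \<open>W > 0\<close> and noise = \<open>noise > 0\<close> and \<eta> = \<open>\<eta> > 0\<close> and U = \<open>unitary_mat N U\<close>
  define J where "J = {1..K} - {i}"
  have J: "finite J" "i \<notin> J" "{1..K} = insert i J" using \<open>i \<in> {1..K}\<close> by (auto simp: J_def)
  define R where "R = rx_cov Ma H Q J"
  have Hi: "H i \<in> carrier_mat N Ma" using assms by blast
  have HJ: "H j \<in> carrier_mat N Ma" and QJ: "psd_mat N (Q j)" if "j \<in> J" for j
    using assms(9,11) that by (auto simp: J_def)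
  have R: "psd_mat Ma R" unfolding R_def using J HJ QJ by (intro psd_rx_cov[where N = N]) auto
  have G: "G = H i * inv_sqrt_mat (complex_of_real noise \<cdot>\<^sub>m 1\<^sub>m Ma + R)"
    using assms(14) by (simp add: R_def J_def)
  have Gc: "G \<in> carrier_mat N Ma"
    unfolding G using Hi inv_sqrt_mat_props(1)[OF R noise] by (auto simp: psd_mat_def)
  have a: "a = 1 / \<eta> * (\<Sum>j\<in>J. real_trace (Q j)) + Pc"
    using assms(12) by (simp add: total_power_def J_def)
  have "(\<Sum>j\<in>J. real_trace (Q j)) \<ge> 0" using real_trace_nonneg QJ by (intro sum_nonneg) auto
  \<comment> \<open>This positivity gives both the strict decrease of \<open>\<Phi>\<close> and
    positive denominators.\<close>
  hence a0: "a > 0" unfolding a using \<eta> \<open>Pc > 0\<close> by (intro add_nonneg_pos) auto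
  have b: "b = W * log 2 (real_det (1\<^sub>m Ma + complex_of_real (1 / noise) \<cdot>\<^sub>m R))"
    using assms(13) by (simp add: sum_rate_def R_def J_def)
  obtain r where "r \<ge> 1" "det (1\<^sub>m Ma + complex_of_real (1 / noise) \<cdot>\<^sub>m R) = complex_of_real r"
    using det_one_add_psd[OF psd_mat_smult[OF R, of "1 / noise"]] noise by auto
  hence b0: "b \<ge> 0" unfolding b using W by (simp add: real_det_def)
  have den: "real_trace X / \<eta> + a > 0" if "psd_mat N X" for X
    using real_trace_nonneg[OF that] \<eta> a0 by (intro add_nonneg_pos) auto
  have d0: "d k \<ge> 0" if "k < N" for k
    using assms(19,20) that by (cases "k < L") (auto intro: less_imp_le)
  have sd: "s l k = (if d k > 0 then max (W * \<eta> / (l * ln 2) - 1 / d k) 0 else 0)" if "k < N" for l k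
    using assms(19,20) that by (auto simp: s)
  \<comment> \<open>Coordinates from \<open>L\<close> on carry no power and contribute
    \<open>log 2 1 = 0\<close>, so the sums may run over all \<open>N\<close> coordinates.\<close>
  have \<Phi>N: "\<Phi> l = b + (W * (\<Sum>k<N. log 2 (1 + s l k * d k)) - l * (1 / \<eta> * (\<Sum>k<N. s l k))) - l * a" for l
  proof -
    have "(\<Sum>k<N. log 2 (1 + s l k * d k)) = (\<Sum>k<L. log 2 (1 + s l k * d k))"
      using \<open>L \<le> N\<close> by (intro sum.mono_neutral_right) (auto simp: s)
    moreover have "(\<Sum>k<N. s l k) = (\<Sum>k<L. s l k)"
      using \<open>L \<le> N\<close> by (intro sum.mono_neutral_right) (auto simp: s)
    ultimately show ?thesis by (simp add: \<Phi> s distrib_left)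
  qed
  let ?X = "\<lambda>l. U * real_diag N (s l) * mat_adjoint U"
  have psdX: "psd_mat N (?X l)" for l
    by (intro psd_mat_congruence[OF psd_mat_real_diag unitary_matD(1)[OF U]]) (simp add: s)
  \<comment> \<open>The water-filling value plus the constant \<open>b - l * a\<close> is
    \<open>\<Phi> l\<close>, attained at \<open>?X l\<close> only.\<close>
  have opt: "rate X - l * (real_trace X / \<eta> + a) \<le> \<Phi> l"
      "rate X - l * (real_trace X / \<eta> + a) = \<Phi> l \<longleftrightarrow> X = ?X l"
    if "l > 0" "psd_mat N X" for l X
    using water_filling[OF W \<eta> that(1) Gc U assms(16) d0 sd that(2)]
    unfolding \<Phi>N rate by (auto simp: distrib_left)
  \<comment> \<open>Only the summand of user \<open>i\<close> depends on \<open>X\<close>; splitting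
    it off leaves the fixed interference \<open>R\<close>, and whitening separates the rate.\<close>
  have eqEE: "EE X = EE' X" if X: "psd_mat N X" for X
  proof -
    have Xc: "X \<in> carrier_mat N N" using X by (simp add: psd_mat_def)
    have "rx_cov Ma H (Q(i := X)) {1..K} = mat_adjoint (H i) * X * H i + rx_cov Ma H (Q(i := X)) J"
      unfolding J(3) using rx_cov_insert[of J i H N Ma "Q(i := X)"] J(1,2) Hi Xc by simp
    also have "rx_cov Ma H (Q(i := X)) J = R"
      unfolding R_def using J(2) by (intro rx_cov_cong) auto
    finally have cov: "rx_cov Ma H (Q(i := X)) {1..K} = mat_adjoint (H i) * X * H i + R" .
  have "sum_rate W noise Ma H (Q(i := X)) {1..K} = rate X"
      unfolding sum_rate_def rate b cov
      using log_det_whitening[OF Hi X R noise] by (simp add: distrib_left flip: G)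
    moreover have "(\<Sum>j\<in>J. real_trace ((Q(i := X)) j)) = (\<Sum>j\<in>J. real_trace (Q j))"
      using J(2) by (intro sum.cong) auto
    hence "total_power \<eta> Pc (Q(i := X)) {1..K} = real_trace X / \<eta> + a"
      unfolding total_power_def a J(3) using J(1,2) by (simp add: distrib_left)
    ultimately show ?thesis by (simp add: EE EE')
  qed
  have arg1: "is_arg_max (\<lambda>X. rate X - l * (real_trace X / \<eta> + a)) (psd_mat N) X \<longleftrightarrow> X = ?X l"
    if "l > 0" for l X
    using opt[OF that] by (intro is_arg_max_iff_unique[where m = "\<Phi> l"] psdX)
  \<comment> \<open>Dinkelbach's argument: as the denominator is positive,
    \<open>EE' X \<le> l\<close> says that the parametric objective is at most
    \<open>\<Phi> l = 0\<close>, and the equality cases coincide.\<close>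
  have bound: "EE' X \<le> l" "EE' X = l \<longleftrightarrow> X = ?X l" if "l > 0" "\<Phi> l = 0" "psd_mat N X" for l X
    using opt[OF that(1,3)] den[OF that(3)] that(2) by (simp_all add: EE' pos_divide_le_eq divide_eq_eq)
  have arg3: "is_arg_max EE' (psd_mat N) X \<longleftrightarrow> X = ?X l" if "l > 0" "\<Phi> l = 0" for l X
    using bound[OF that] by (intro is_arg_max_iff_unique[where m = l] psdX)
  have arg2: "is_arg_max EE (psd_mat N) X \<longleftrightarrow> X = ?X l" if "l > 0" "\<Phi> l = 0" for l X
    using bound[OF that] eqEE by (intro is_arg_max_iff_unique[where m = l] psdX) auto
  have root: "\<exists>!l. l > 0 \<and> \<Phi> l = 0"
    using water_filling_root[OF W \<eta> a0 b0 \<open>1 \<le> L\<close> assms(19) \<Phi>] .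
  show ?thesis using arg1 arg2 arg3 eqEE root by auto
qed

end
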